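(* Let $F$ be a finite field with $q$ elements and $G$ a finite abelian group of order $m$. Let $r\in(0,1)$ and $\delta\in(0,1-q^{-1})$. For each positive integer $n$ put $k=[rn]$ (the integer nearest to $rn$), and let $A=(a_{ij})$ be a $k\times n$ matrix over the group algebra $FG$ chosen uniformly at random from $(FG)^{k\times n}$. Let $C_A=\{\mathbf{b}A \mid \mathbf{b}\in (FG)^k\}\subseteq (FG)^n$ and let $\Delta(C_A)$ be its relative distance. Then $$\lim_{n\to\infty}\Pr\big(\Delta(C_A)>\delta\big)=\begin{cases}1,& \text{if } r<g_q(\delta),\\ 0,& \text{if } r>g_q(\delta),\end{cases}$$ and both limits converge exponentially fast.
   Context: Each element $a=\sum_{z\in G}a_z z$ of $FG$ ($a_z\in F$) is identified with the word $(a_z)_{z\in G}\in F^m$, and an element $(a_1,\dots,a_n)\in(FG)^n$ with the concatenated word of length $mn$ over $F$; its Hamming weight is $\mathrm{w}(a_1,\dots,a_n)=\sum_i\mathrm{w}(a_i)$. For $\mathbf{b}=(b_1,\dots,b_k)\in(FG)^k$, $\mathbf{b}A=(\sum_i b_ia_{i1},\dots,\sum_i b_ia_{in})$ with products in $FG$. The relative distance is $\Delta(C_A)=\mathrm{w}(C_A)/(mn)$ where $\mathrm{w}(C_A)$ is the minimum Hamming weight of the nonzero codewords. The $q$-ary entropy is $h_q(x)=x\log_q(q-1)-x\log_q x-(1-x)\log_q(1-x)$ (with $0\log_q 0=0$), and $g_q(x)=1-h_q(x)$ is the GV-bound. *)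

theory Defs
  imports "HOL-Analysis.Analysis" "HOL-Library.Extended_Nat" "HOL-Library.Extended_Real"
begin

text \<open>Group algebra FG: elements are functions G \<Rightarrow> F (coefficient vectors),
  G a finite abelian group written additively. Product = convolution.\<close>

type_synonym ('g, 'f) galg = "'g \<Rightarrow> 'f"

definition galg_mult :: "('g::{ab_group_add,finite}, 'f::field) galg \<Rightarrow> ('g, 'f) galg \<Rightarrow> ('g, 'f) galg" where
  "galg_mult a b = (\<lambda>z. \<Sum>x\<in>UNIV. a x * b (z - x))"

definition galg_weight :: "('g::finite, 'f::zero) galg \<Rightarrow> nat" where
  "galg_weight a = card {z. a z \<noteq> 0}"

definition word_weight :: "nat \<Rightarrow> (nat \<Rightarrow> ('g::finite, 'f::zero) galg) \<Rightarrow> nat" where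
  "word_weight n c = (\<Sum>j<n. galg_weight (c j))"

definition code_of :: "nat \<Rightarrow> nat \<Rightarrow> (nat \<times> nat \<Rightarrow> ('g::{ab_group_add,finite}, 'f::field) galg)
    \<Rightarrow> (nat \<Rightarrow> ('g, 'f) galg) set" where
  "code_of k n A = (\<lambda>b. (\<lambda>j\<in>{..<n}. \<lambda>z. \<Sum>i<k. galg_mult (b i) (A (i, j)) z)) ` ({..<k} \<rightarrow>\<^sub>E UNIV)"

text \<open>Minimum Hamming weight of nonzero codewords (infinity for the zero code).\<close>
definition min_weight :: "nat \<Rightarrow> (nat \<Rightarrow> ('g::finite, 'f::zero) galg) set \<Rightarrow> enat" where
  "min_weight n C = (INF c\<in>{c\<in>C. \<exists>j<n. \<exists>z. c j z \<noteq> 0}. enat (word_weight n c))"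

definition rel_distance :: "nat \<Rightarrow> (nat \<Rightarrow> ('g::finite, 'f::zero) galg) set \<Rightarrow> ereal" where
  "rel_distance n C = (case min_weight n C of
      enat w \<Rightarrow> ereal (real w / (real CARD('g) * real n))
    | \<infinity> \<Rightarrow> \<infinity>)"

definition xlogx :: "real \<Rightarrow> real \<Rightarrow> real" where
  "xlogx q x = (if x = 0 then 0 else x * log q x)"

definition hq :: "real \<Rightarrow> real \<Rightarrow> real" where
  "hq q x = x * log q (q - 1) - xlogx q x - xlogx q (1 - x)"

definition gq :: "real \<Rightarrow> real \<Rightarrow> real" where
  "gq q x = 1 - hq q x"

definition prob_dist_gt :: "'f::{field,finite} itself \<Rightarrow> 'g::{ab_group_add,finite} itself
    \<Rightarrow> real \<Rightarrow> real \<Rightarrow> nat \<Rightarrow> real" where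
  "prob_dist_gt _ _ r \<delta> n =
    (let k = nat (round (r * real n));
         M = ({..<k} \<times> {..<n}) \<rightarrow>\<^sub>E (UNIV :: ('g, 'f) galg set)
     in real (card {A\<in>M. rel_distance n (code_of k n A) > ereal \<delta>}) / real (card M))"

end

theory Submission
  imports Defs "HOL-Library.Function_Algebras" "HOL-Real_Asymp.Real_Asymp"
begin

text \<open>For fixed \<open>b\<close> the codeword \<open>bA\<close> is uniform on \<open>J\<^sup>n\<close>, where \<open>J\<close> is the ideal generated by the
  entries of \<open>b\<close>. Translating an information set of \<open>J\<close> by the elements of \<open>G\<close> shows that every coset
  of \<open>J\<^sup>n\<close> contains at most \<open>|J|\<close> to the power \<open>n h\<^sub>q(\<delta>)\<close> words of relative weight at most \<open>\<delta>\<close>. Below the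
  GV-bound the theorem is then a union bound over \<open>b\<close>, grouped by the finitely many ideals \<open>J\<close>.
  Above it, a second moment argument applies to the codewords \<open>bA\<close> with \<open>b = (1, x)\<close>: the pair given by
  \<open>x\<close> and \<open>x'\<close> is uniform on the pairs of words congruent modulo \<open>J\<^sup>n\<close>, with \<open>J\<close> generated by \<open>x' - x\<close>,
  so the coset bound controls the correlations.\<close>

section \<open>Functions extended by zero\<close>

text \<open>\<open>FG\<close> is in general not a field, so \<open>bA\<close> may be confined to the
  power of a proper ideal, where light words can be much more likely. A balance makes up for this:
  an ideal \<open>J\<close> is generated only by vectors with entries in \<open>J\<close>, at most
  \<open>|J|^k\<close> of them, and each yields a light nonzero word with probability at most
  \<open>|J|^(-n g)\<close>, where \<open>g\<close> is the GV-bound. So \<open>J\<close> contributes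
  at most \<open>|J|^(k - n g)\<close>, and the number of ideals does not depend on
  \<open>n\<close>. Below the bound the exponent is negative, and the worst case is the smallest
  nonzero ideal, with \<open>|J| >= q\<close>. Above it, the excess in the second moment comes from
  proper ideals, with \<open>|J| <= |FG|/q\<close>; against an expected number of about
  \<open>|FG|^(k - 1 - n g)\<close> light codewords this leaves a factor
  \<open>q^(-(k - 1 - n g))\<close>. The leading entry 1 makes each \<open>bA\<close> uniform on all
  of \<open>(FG)^n\<close> and costs one coordinate, hence \<open>k - 1\<close>.\<close>

text \<open>The value outside \<open>S\<close> is \<open>0\<close> rather than \<open>undefined\<close>, so that these functions form additive groups.\<close>

definition zext :: "'i set \<Rightarrow> 'a::zero set \<Rightarrow> ('i \<Rightarrow> 'a) set" where
  "zext S B = {f. (\<forall>i\<in>S. f i \<in> B) \<and> (\<forall>i. i \<notin> S \<longrightarrow> f i = 0)}"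

lemma bij_betw_zext_PiE: "bij_betw (\<lambda>f. restrict f S) (zext S B) (S \<rightarrow>\<^sub>E B)"
proof (rule bij_betwI[where g = "\<lambda>f i. if i \<in> S then f i else 0"])
  show "(\<lambda>f. restrict f S) \<in> zext S B \<rightarrow> (S \<rightarrow>\<^sub>E B)"
    by (auto simp: zext_def)
  show "(\<lambda>f i. if i \<in> S then f i else 0) \<in> (S \<rightarrow>\<^sub>E B) \<rightarrow> zext S B"
    by (auto simp: zext_def PiE_def)
  show "(\<lambda>i. if i \<in> S then restrict f S i else 0) = f" if "f \<in> zext S B" for f
    using that by (auto simp: zext_def fun_eq_iff)
  show "restrict (\<lambda>i. if i \<in> S then f i else 0) S = f" if "f \<in> S \<rightarrow>\<^sub>E B" for f
    using that by (auto simp: PiE_def extensional_def fun_eq_iff)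
qed

lemma card_zext: "finite S \<Longrightarrow> card (zext S B) = card B ^ card S"
  using bij_betw_same_card[OF bij_betw_zext_PiE, of S B] by (simp add: card_PiE)

lemma finite_zext: "finite S \<Longrightarrow> finite B \<Longrightarrow> finite (zext S B)"
  using bij_betw_finite[OF bij_betw_zext_PiE, of S B] by (simp add: finite_PiE)

lemma zext_add: "f \<in> zext S UNIV \<Longrightarrow> g \<in> zext S UNIV \<Longrightarrow> f + g \<in> zext S (UNIV :: 'a::monoid_add set)"
  by (auto simp: zext_def)

lemma zext_diff: "f \<in> zext S UNIV \<Longrightarrow> g \<in> zext S UNIV \<Longrightarrow> f - g \<in> zext S (UNIV :: 'a::group_add set)"
  by (auto simp: zext_def)

text \<open>Weights add over the \<open>n\<close> entries, so this turns the weight enumerator of a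
  coset of \<open>J^n\<close> into a product. The factor \<open>F i\<close> may vary with
  \<open>i\<close>, as the offset of the coset does.\<close>

lemma sum_zext_prod:
  fixes F :: "'i \<Rightarrow> 'a::zero \<Rightarrow> 'c::comm_semiring_1"
  assumes "finite S" "finite B"
  shows "(\<Sum>f\<in>zext S B. \<Prod>i\<in>S. F i (f i)) = (\<Prod>i\<in>S. \<Sum>y\<in>B. F i y)"
proof -
  have "(\<Prod>i\<in>S. \<Sum>y\<in>B. F i y) = (\<Sum>f\<in>S \<rightarrow>\<^sub>E B. \<Prod>i\<in>S. F i (f i))"
    using assms by (intro prod_sum_PiE) auto
  also have "\<dots> = (\<Sum>f\<in>zext S B. \<Prod>i\<in>S. F i (restrict f S i))"
    by (rule sum.reindex_bij_betw[OF bij_betw_zext_PiE, symmetric])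
  finally show ?thesis by simp
qed

section \<open>Words of small weight in cosets of ideals\<close>

text \<open>The ideals of \<open>FG\<close>: the group elements span \<open>FG\<close> over
  \<open>F\<close> and act by translation, so a subspace is an ideal exactly when translations
  preserve it.\<close>

definition shift_subspace :: "('g::ab_group_add \<Rightarrow> 'f::field) set \<Rightarrow> bool" where
  "shift_subspace J \<longleftrightarrow> 0 \<in> J \<and> (\<forall>a\<in>J. \<forall>b\<in>J. a + b \<in> J) \<and>
     (\<forall>c. \<forall>a\<in>J. (\<lambda>z. c * a z) \<in> J) \<and> (\<forall>g. \<forall>a\<in>J. (\<lambda>z. a (z - g)) \<in> J)"

lemma shift_subspace_diff:
  assumes "shift_subspace J" "a \<in> J" "b \<in> J"
  shows "a - b \<in> J"
proof -
  have "(\<lambda>z. - 1 * b z) \<in> J" using assms unfolding shift_subspace_def by blast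
  then have "a + (\<lambda>z. - 1 * b z) \<in> J" using assms unfolding shift_subspace_def by blast
  moreover have "a + (\<lambda>z. - 1 * b z) = a - b" by (auto simp: fun_eq_iff)
  ultimately show ?thesis by simp
qed

lemma shift_subspace_sum:
  assumes "shift_subspace J" "finite I" "\<And>i. i \<in> I \<Longrightarrow> v i \<in> J"
  shows "(\<Sum>i\<in>I. v i) \<in> J"
  using assms(2,3) by (induction I rule: finite_induct) (use assms(1) in \<open>auto simp: shift_subspace_def\<close>)

lemma sum_fun_apply: "(\<Sum>i\<in>I. v i) z = (\<Sum>i\<in>I. v i z)"
  by (induction I rule: infinite_finite_induct) auto

lemma card_field_ge_2: "CARD('f::{field,finite}) \<ge> 2"
proof -
  have "card {0, 1 :: 'f} \<le> CARD('f)" by (intro card_mono) auto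
  then show ?thesis by simp
qed

text \<open>A minimal set of coordinates determining the elements of \<open>J\<close> can be prescribed freely.\<close>

lemma information_set:
  fixes J :: "('g::{ab_group_add,finite} \<Rightarrow> 'f::{field,finite}) set"
  assumes J: "shift_subspace J"
  obtains I where "\<And>a. a \<in> J \<Longrightarrow> (\<forall>z\<in>I. a z = 0) \<Longrightarrow> a = 0" and "card J = CARD('f) ^ card I"
proof -
  define D where "D I \<longleftrightarrow> (\<forall>a\<in>J. (\<forall>z\<in>I. a z = 0) \<longrightarrow> a = 0)" for I :: "'g set"
  have "D UNIV" by (auto simp: D_def)
  then obtain I where I: "D I" and min: "\<And>I'. I' \<subset> I \<Longrightarrow> \<not> D I'"
    using finite_psubset_induct[of UNIV "\<lambda>I. D I \<longrightarrow> (\<exists>I. D I \<and> (\<forall>I'. I' \<subset> I \<longrightarrow> \<not> D I'))"]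
    by (metis finite_UNIV finite_code)
  \<comment> \<open>Minimality at work: a nonzero element of \<open>J\<close> that vanishes on
    \<open>I - {i}\<close> cannot vanish at \<open>i\<close>; scaling it gives a dual basis vector
    for \<open>i\<close>.\<close>
  have "\<exists>v\<in>J. \<forall>j\<in>I. v j = (if j = i then 1 else 0)" if i: "i \<in> I" for i
  proof -
    have "\<not> D (I - {i})" using i by (intro min) auto
    then obtain a where a: "a \<in> J" "\<forall>z\<in>I - {i}. a z = 0" "a \<noteq> 0" by (auto simp: D_def)
    then have "a i \<noteq> 0" using I by (auto simp: D_def)
    moreover have "(\<lambda>z. inverse (a i) * a z) \<in> J" using J a by (auto simp: shift_subspace_def)
    ultimately show ?thesis using a by (intro bexI[of _ "\<lambda>z. inverse (a i) * a z"]) auto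
  qed
  then obtain v where v: "\<And>i. i \<in> I \<Longrightarrow> v i \<in> J"
      "\<And>i j. i \<in> I \<Longrightarrow> j \<in> I \<Longrightarrow> v i j = (if j = i then 1 else 0)"
    by metis
  have "bij_betw (\<lambda>a. restrict a I) J (I \<rightarrow>\<^sub>E UNIV)"
    unfolding bij_betw_def
  proof (intro conjI inj_onI equalityI subsetI)
    fix a b assume ab: "a \<in> J" "b \<in> J" "restrict a I = restrict b I"
    have "a - b \<in> J" using J ab shift_subspace_diff by blast
    moreover have "\<forall>z\<in>I. (a - b) z = 0"
      using ab(3) by (metis fun_diff_def diff_self restrict_apply')
    ultimately have "a - b = 0" using I by (auto simp: D_def)
    then show "a = b" by simp
  next
    fix f :: "'g \<Rightarrow> 'f" assume f: "f \<in> I \<rightarrow>\<^sub>E UNIV"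
    define a where "a = (\<Sum>i\<in>I. (\<lambda>z. f i * v i z))"
    have "a \<in> J" unfolding a_def
      using J v(1) by (intro shift_subspace_sum[OF J]) (auto simp: shift_subspace_def)
    moreover have "a z = f z" if "z \<in> I" for z
    proof -
      have "a z = (\<Sum>i\<in>I. if i = z then f i else 0)"
        unfolding a_def sum_fun_apply using that by (intro sum.cong) (auto simp: v(2))
      then show ?thesis using that by simp
    qed
    then have "restrict a I = f" using f by (auto simp: fun_eq_iff PiE_def extensional_def)
    ultimately show "f \<in> (\<lambda>a. restrict a I) ` J" by blast
  qed auto
  then have "card J = card (I \<rightarrow>\<^sub>E (UNIV :: 'f set))" by (rule bij_betw_same_card)
  also have "\<dots> = CARD('f) ^ card I" by (simp add: card_PiE)
  finally show ?thesis using that I by (auto simp: D_def)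
qed

text \<open>Double counting: for fixed \<open>z\<close> the map \<open>g \<mapsto> z + g\<close>
  permutes \<open>G\<close>, so each \<open>z\<close> in \<open>I\<close> meets the support of
  \<open>a\<close> exactly \<open>galg_weight a\<close> times.\<close>

lemma galg_weight_translates:
  fixes a :: "'g::{ab_group_add,finite} \<Rightarrow> 'f::zero"
  shows "(\<Sum>g\<in>UNIV. card {z\<in>I. a (z + g) \<noteq> 0}) = card I * galg_weight a"
proof -
  have "(\<Sum>g\<in>UNIV. card {z\<in>I. a (z + g) \<noteq> 0})
      = (\<Sum>g\<in>UNIV. \<Sum>z\<in>I. if a (z + g) \<noteq> 0 then 1 else 0)"
    by (intro sum.cong refl) (simp add: sum.If_cases Int_def)
  also have "\<dots> = (\<Sum>z\<in>I. \<Sum>g\<in>UNIV. if a (z + g) \<noteq> 0 then 1 else 0)"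
    by (rule sum.swap)
  also have "\<dots> = (\<Sum>z\<in>I. \<Sum>g\<in>UNIV. if a g \<noteq> 0 then 1 else 0)"
  proof (rule sum.cong[OF refl])
    fix z assume "z \<in> I"
    have "bij ((+) z)" by (simp add: bij_plus_right)
    then show "(\<Sum>g\<in>UNIV. if a (z + g) \<noteq> 0 then 1 else 0) = (\<Sum>g\<in>UNIV. if a g \<noteq> 0 then 1 else (0::nat))"
      by (rule sum.reindex_bij_betw)
  qed
  also have "\<dots> = card I * galg_weight a"
    by (simp add: galg_weight_def sum.If_cases)
  finally show ?thesis .
qed

text \<open>The weight enumerator of the full space on \<open>I\<close>: at each position the value
  0 contributes 1 and each of the other \<open>q - 1\<close> values contributes \<mu>.\<close>

lemma sum_power_weight_PiE:
  fixes \<mu> :: real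
  assumes "finite I"
  shows "(\<Sum>f\<in>I \<rightarrow>\<^sub>E (UNIV :: 'f::{field,finite} set). \<mu> ^ card {z\<in>I. f z \<noteq> 0})
    = (1 + (real CARD('f) - 1) * \<mu>) ^ card I"
proof -
  have "(\<Sum>f\<in>I \<rightarrow>\<^sub>E (UNIV :: 'f set). \<mu> ^ card {z\<in>I. f z \<noteq> 0})
      = (\<Sum>f\<in>I \<rightarrow>\<^sub>E (UNIV :: 'f set). \<Prod>z\<in>I. if f z \<noteq> 0 then \<mu> else 1)"
    using assms by (intro sum.cong refl) (simp add: prod.If_cases Int_def)
  also have "\<dots> = (\<Prod>z\<in>I. \<Sum>y\<in>(UNIV :: 'f set). if y \<noteq> 0 then \<mu> else 1)"
    using assms by (intro prod_sum_PiE[symmetric]) auto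
  also have "(\<Sum>y\<in>(UNIV :: 'f set). if y \<noteq> 0 then \<mu> else 1) = 1 + (real CARD('f) - 1) * \<mu>"
  proof -
    have "(\<Sum>y\<in>(UNIV :: 'f set). if y \<noteq> 0 then \<mu> else 1) = 1 + (\<Sum>y\<in>UNIV - {0 :: 'f}. \<mu>)"
      by (subst sum.remove[of _ 0]) (auto intro!: sum.cong)
    moreover have "real (CARD('f) - 1) = real CARD('f) - 1"
      using card_field_ge_2[where 'f='f] by (simp add: of_nat_diff)
    ultimately show ?thesis by (simp add: card_Diff_singleton)
  qed
  finally show ?thesis by simp
qed

text \<open>All translates of an information set are information sets, and together they cover each
  coordinate equally often; the AM-GM inequality over the translates bounds the weight
  enumerator of every coset of \<open>J\<close> by that of a full space of the same dimension.\<close>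

lemma coset_weight_enumerator_le:
  fixes J :: "('g::{ab_group_add,finite} \<Rightarrow> 'f::{field,finite}) set"
  assumes J: "shift_subspace J" and card: "card J = CARD('f) ^ d" and \<mu>: "\<mu> > 0"
  shows "(\<Sum>a\<in>J. \<mu> powr (real d / real CARD('g) * real (galg_weight (u + a))))
    \<le> (1 + (real CARD('f) - 1) * \<mu>) ^ d"
proof -
  obtain I where I: "\<And>a. a \<in> J \<Longrightarrow> (\<forall>z\<in>I. a z = 0) \<Longrightarrow> a = 0" and "card J = CARD('f) ^ card I"
    using information_set[OF J] by blast
  then have d: "d = card I" using card card_field_ge_2[where 'f='f] by simp
  define m where "m = real CARD('g)"
  have m: "m > 0" by (simp add: m_def)
  define W where "W g a = card {z\<in>I. (u + a) (z + g) \<noteq> 0}" for g a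
  \<comment> \<open>\<open>d / m\<close> times the weight is the average of \<open>W g a\<close>
    over \<open>g\<close>, so the left side is the geometric mean of the numbers
    \<open>\<mu> ^ W g a\<close>.\<close>
  have amgm: "\<mu> powr (real d / m * real (galg_weight (u + a))) \<le> (\<Sum>g\<in>UNIV. \<mu> ^ W g a / m)" for a
  proof -
    have "(\<Prod>g\<in>UNIV. \<mu> ^ W g a) = \<mu> ^ (\<Sum>g\<in>UNIV. W g a)" by (simp add: power_sum)
    also have "\<dots> = \<mu> ^ (d * galg_weight (u + a))"
      unfolding W_def galg_weight_translates d ..
    finally have "(\<Prod>g\<in>UNIV. \<mu> ^ W g a) powr (1 / m) = \<mu> powr (real d / m * real (galg_weight (u + a)))"
      using \<mu> by (simp add: powr_realpow[symmetric] powr_powr)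
    moreover have "(\<Prod>g\<in>UNIV. \<mu> ^ W g a) powr (1 / m) \<le> (\<Sum>g\<in>UNIV. \<mu> ^ W g a / m)"
      unfolding m_def using \<mu> by (intro arith_geom_mean) auto
    ultimately show ?thesis by simp
  qed
  \<comment> \<open>The offset \<open>u\<close> cancels in differences, and a difference vanishing
    on \<open>I\<close> translated by \<open>g\<close> becomes, after shifting back, an element of
    \<open>J\<close> vanishing on \<open>I\<close>. Hence the coset embeds into the full space on
    \<open>I\<close>.\<close>
  have one: "(\<Sum>a\<in>J. \<mu> ^ W g a) \<le> (1 + (real CARD('f) - 1) * \<mu>) ^ d" for g
  proof -
    define \<rho> where "\<rho> a = restrict (\<lambda>z. (u + a) (z + g)) I" for a
    have inj: "inj_on \<rho> J"
    proof (rule inj_onI)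
      fix a b assume ab: "a \<in> J" "b \<in> J" "\<rho> a = \<rho> b"
      have "a (z + g) = b (z + g)" if "z \<in> I" for z
        using fun_cong[OF ab(3), of z] that by (simp add: \<rho>_def)
      moreover have "(\<lambda>z. (a - b) (z - (- g))) \<in> J"
        using J shift_subspace_diff[OF J ab(1,2)] unfolding shift_subspace_def by blast
      ultimately have "(\<lambda>z. (a - b) (z - (- g))) = 0" by (intro I) auto
      then have "(a - b) z = 0" for z
        by (metis add_diff_cancel_right' zero_fun_apply)
      then show "a = b" by (auto simp: fun_eq_iff)
    qed
    have "(\<Sum>a\<in>J. \<mu> ^ W g a) = (\<Sum>a\<in>J. \<mu> ^ card {z\<in>I. \<rho> a z \<noteq> 0})"
      unfolding W_def \<rho>_def by (intro sum.cong refl arg_cong[of _ _ "\<lambda>S. \<mu> ^ card S"]) auto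
    also have "\<dots> = (\<Sum>f\<in>\<rho> ` J. \<mu> ^ card {z\<in>I. f z \<noteq> 0})"
      using inj by (simp add: sum.reindex)
    also have "\<dots> \<le> (\<Sum>f\<in>I \<rightarrow>\<^sub>E (UNIV :: 'f set). \<mu> ^ card {z\<in>I. f z \<noteq> 0})"
      using \<mu> by (intro sum_mono2) (auto simp: \<rho>_def finite_PiE)
    also have "\<dots> = (1 + (real CARD('f) - 1) * \<mu>) ^ d"
      unfolding d by (rule sum_power_weight_PiE) simp
    finally show ?thesis .
  qed
  have "(\<Sum>a\<in>J. \<mu> powr (real d / m * real (galg_weight (u + a))))
      \<le> (\<Sum>a\<in>J. \<Sum>g\<in>UNIV. \<mu> ^ W g a / m)"
    by (intro sum_mono amgm)
  also have "\<dots> = (\<Sum>g\<in>UNIV. \<Sum>a\<in>J. \<mu> ^ W g a / m)" by (rule sum.swap)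
  also have "\<dots> = (\<Sum>g\<in>UNIV. (\<Sum>a\<in>J. \<mu> ^ W g a) / m)" by (simp add: sum_divide_distrib)
  also have "\<dots> \<le> (\<Sum>g\<in>(UNIV::'g set). (1 + (real CARD('f) - 1) * \<mu>) ^ d / m)"
    using m by (intro sum_mono divide_right_mono one) auto
  also have "\<dots> = (1 + (real CARD('f) - 1) * \<mu>) ^ d" using m by (simp add: m_def)
  finally show ?thesis by (simp add: m_def)
qed

text \<open>The minimiser of \<open>\<mu> powr (- \<delta>) * (1 + (q - 1) * \<mu>)\<close> is
  \<open>\<delta> / ((1 - \<delta>) * (q - 1))\<close>, where the second factor equals
  \<open>1 / (1 - \<delta>)\<close>; the right side is this minimum. The identity is checked on
  logarithms.\<close>

lemma powr_hq:
  fixes q \<delta> :: real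
  assumes "q > 1" "0 < \<delta>" "\<delta> < 1"
  shows "q powr hq q \<delta> = (\<delta> / ((1 - \<delta>) * (q - 1))) powr (- \<delta>) / (1 - \<delta>)"
proof -
  have "ln (q powr hq q \<delta>) = hq q \<delta> * ln q" using assms by (simp add: ln_powr)
  also have "\<dots> = \<delta> * ln (q - 1) - \<delta> * ln \<delta> - (1 - \<delta>) * ln (1 - \<delta>)"
    using assms by (simp add: hq_def xlogx_def log_def field_simps)
  also have "\<dots> = ln ((\<delta> / ((1 - \<delta>) * (q - 1))) powr (- \<delta>) / (1 - \<delta>))"
  proof -
    define \<rho> where "\<rho> = \<delta> / ((1 - \<delta>) * (q - 1))"
    have "\<rho> > 0" using assms by (simp add: \<rho>_def)
    moreover have "ln \<delta> = ln \<rho> + ln (1 - \<delta>) + ln (q - 1)"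
      unfolding \<rho>_def using assms by (subst ln_div, simp, simp, subst ln_mult) auto
    ultimately show ?thesis
      unfolding \<rho>_def[symmetric] using assms by (subst ln_div) (auto simp: ln_powr algebra_simps)
  qed
  finally show ?thesis
    using assms by (subst (asm) ln_inj_iff) auto
qed

text \<open>A Chernoff bound: every word of the ball is counted with a weight of at least 1, and the
  resulting exponential sum factors into coset enumerators. The offset \<open>u\<close> will be 0 in
  the union bound and a codeword in the second moment.\<close>

lemma card_coset_ball_le:
  fixes J :: "('g::{ab_group_add,finite} \<Rightarrow> 'f::{field,finite}) set" and \<delta> :: real
  defines "q \<equiv> real CARD('f)"
  assumes J: "shift_subspace J" and \<delta>: "0 < \<delta>" "\<delta> < 1 - 1 / q"
  shows "real (card {v\<in>zext {..<n} J. real (word_weight n (u + v)) \<le> \<delta> * (real CARD('g) * real n)})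
    \<le> real (card J) powr (real n * hq q \<delta>)"
proof -
  define m where "m = real CARD('g)"
  have m: "m > 0" by (simp add: m_def)
  have q: "q \<ge> 2" using card_field_ge_2[where 'f='f] by (simp add: q_def)
  then have \<delta>1: "\<delta> < 1" using \<delta> by (smt (verit) divide_pos_pos)
  obtain I :: "'g set" where cJ: "card J = CARD('f) ^ card I"
    by (rule information_set[OF J])
  define d where "d = card I"
  \<comment> \<open>The minimiser from \<open>powr_hq\<close>. The condition
    \<open>\<delta> < 1 - 1 / q\<close> amounts to \<open>\<mu> < 1\<close>, so powers of \<mu> with
    nonpositive exponent are at least 1.\<close>
  define \<mu> where "\<mu> = \<delta> / ((1 - \<delta>) * (q - 1))"
  have \<mu>0: "\<mu> > 0" using \<delta> \<delta>1 q by (simp add: \<mu>_def)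
  have \<mu>1: "\<mu> \<le> 1" using \<delta> \<delta>1 q by (simp add: \<mu>_def field_simps)
  have e: "1 + (q - 1) * \<mu> = 1 / (1 - \<delta>)" using \<delta> \<delta>1 q by (simp add: \<mu>_def field_simps)
  let ?Z = "zext {..<n} J"
  let ?w = "\<lambda>v. real (word_weight n (u + v))"
  let ?T = "{v\<in>?Z. ?w v \<le> \<delta> * (m * real n)}"
  have fin: "finite ?Z" by (simp add: finite_zext)
  have "real (card ?T) = (\<Sum>v\<in>?T. 1)" by simp
  also have "\<dots> \<le> (\<Sum>v\<in>?T. \<mu> powr (real d / m * (?w v - \<delta> * (m * real n))))"
  proof (rule sum_mono)
    fix v assume "v \<in> ?T"
    then have "real d / m * (?w v - \<delta> * (m * real n)) \<le> 0"
      using m by (intro mult_nonneg_nonpos) auto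
    then show "1 \<le> \<mu> powr (real d / m * (?w v - \<delta> * (m * real n)))"
      using \<mu>0 \<mu>1 by (metis powr_mono' powr_zero_eq_one less_eq_real_def less_irrefl)
  qed
  also have "\<dots> \<le> (\<Sum>v\<in>?Z. \<mu> powr (real d / m * (?w v - \<delta> * (m * real n))))"
    using fin by (intro sum_mono2) auto
  also have "\<dots> = \<mu> powr (- \<delta> * (real d * real n)) * (\<Sum>v\<in>?Z. \<mu> powr (real d / m * ?w v))"
    unfolding sum_distrib_left
  proof (rule sum.cong[OF refl])
    fix v
    have "real d / m * (?w v - \<delta> * (m * real n)) = - \<delta> * (real d * real n) + real d / m * ?w v"
      using m by (simp add: field_simps)
    then show "\<mu> powr (real d / m * (?w v - \<delta> * (m * real n)))
        = \<mu> powr (- \<delta> * (real d * real n)) * \<mu> powr (real d / m * ?w v)"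
      by (simp only: powr_add)
  qed
  also have "(\<Sum>v\<in>?Z. \<mu> powr (real d / m * ?w v))
      = (\<Sum>v\<in>?Z. \<Prod>j<n. \<mu> powr (real d / m * real (galg_weight (u j + v j))))"
    using \<mu>0 by (simp add: word_weight_def sum_distrib_left powr_sum)
  also have "\<dots> = (\<Prod>j<n. \<Sum>a\<in>J. \<mu> powr (real d / m * real (galg_weight (u j + a))))"
    by (rule sum_zext_prod) auto
  also have "\<mu> powr (- \<delta> * (real d * real n)) * \<dots>
      \<le> \<mu> powr (- \<delta> * (real d * real n)) * (\<Prod>j<n. (1 + (q - 1) * \<mu>) ^ d)"
    unfolding m_def q_def using J cJ \<mu>0
    by (intro mult_left_mono prod_mono conjI sum_nonneg coset_weight_enumerator_le) (auto simp: d_def)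
  also have "(\<Prod>j<n. (1 + (q - 1) * \<mu>) ^ d) = (1 / (1 - \<delta>)) powr (real d * real n)"
    using \<delta>1 by (simp add: e powr_realpow[symmetric] powr_powr)
  also have "\<mu> powr (- \<delta> * (real d * real n)) * (1 / (1 - \<delta>)) powr (real d * real n)
      = (\<mu> powr (- \<delta>) / (1 - \<delta>)) powr (real d * real n)"
    using \<mu>0 \<delta>1 by (simp add: powr_mult powr_divide powr_powr)
  also have "\<dots> = (q powr hq q \<delta>) powr (real d * real n)"
    using powr_hq[of q \<delta>] q \<delta> \<delta>1 by (simp add: \<mu>_def)
  also have "\<dots> = real (card J) powr (real n * hq q \<delta>)"
    using q by (simp add: cJ d_def q_def powr_realpow[symmetric] powr_powr mult_ac)
  finally show ?thesis by (simp only: m_def)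
qed

section \<open>Uniformity of random codewords\<close>

text \<open>The fibres over the image are translates of the kernel and thus equally large: the image
  of a uniform element is uniform. Multiplied out to stay within the naturals.\<close>

lemma card_additive_preimage:
  fixes \<phi> :: "'a::ab_group_add \<Rightarrow> 'b::ab_group_add"
  assumes fin: "finite X" and X: "\<And>x y. x \<in> X \<Longrightarrow> y \<in> X \<Longrightarrow> x + y \<in> X"
    "\<And>x y. x \<in> X \<Longrightarrow> y \<in> X \<Longrightarrow> x - y \<in> X"
    and add: "\<And>x y. x \<in> X \<Longrightarrow> y \<in> X \<Longrightarrow> \<phi> (x + y) = \<phi> x + \<phi> y"
  shows "card {x\<in>X. \<phi> x \<in> T} * card (\<phi> ` X) = card (T \<inter> \<phi> ` X) * card X"
proof -
  define K where "K = {x\<in>X. \<phi> x = 0}"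
  have fibre: "card {x\<in>X. \<phi> x = y} = card K" if y: "y \<in> \<phi> ` X" for y
  proof -
    obtain x0 where x0: "x0 \<in> X" "y = \<phi> x0" using y by blast
    have diff: "\<phi> (x - x0) = \<phi> x - \<phi> x0" if "x \<in> X" for x
      using add[of "x - x0" x0] X(2)[OF that x0(1)] x0(1) by simp
    have "bij_betw (\<lambda>x. x - x0) {x\<in>X. \<phi> x = y} K"
      by (rule bij_betwI[where g = "\<lambda>x. x + x0"]) (auto simp: K_def X x0 diff add)
    then show ?thesis by (rule bij_betw_same_card)
  qed
  have count: "card {x\<in>X. \<phi> x \<in> T'} = card (T' \<inter> \<phi> ` X) * card K" for T'
  proof -
    have "{x\<in>X. \<phi> x \<in> T'} = (\<Union>y\<in>T' \<inter> \<phi> ` X. {x\<in>X. \<phi> x = y})" by auto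
    also have "card \<dots> = (\<Sum>y\<in>T' \<inter> \<phi> ` X. card {x\<in>X. \<phi> x = y})"
      using fin by (intro card_UN_disjoint) auto
    also have "\<dots> = card (T' \<inter> \<phi> ` X) * card K" by (simp add: fibre)
    finally show ?thesis .
  qed
  have "card X = card (\<phi> ` X) * card K" using count[of UNIV] by simp
  then show ?thesis by (simp add: count)
qed

text \<open>Chebyshev's inequality as a count: if \<open>N A\<close> is the number of
  \<open>x\<close> in \<open>E\<close> with \<open>Q A x\<close>, then each \<open>A\<close> with
  \<open>N A = 0\<close> contributes the squared mean to the sum of \<open>(N A - e)^2\<close>.
  \<open>V\<close> bounds the variance.\<close>

lemma second_moment_bound:
  fixes p V :: real
  assumes fin: "finite X" "finite E"
    and first: "\<And>x. x \<in> E \<Longrightarrow> real (card {A\<in>X. Q A x}) = p * real (card X)"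
    and second: "(\<Sum>x\<in>E. \<Sum>y\<in>E. real (card {A\<in>X. Q A x \<and> Q A y}))
       \<le> real (card X) * ((real (card E) * p)\<^sup>2 + V)"
  shows "real (card {A\<in>X. \<forall>x\<in>E. \<not> Q A x}) * (real (card E) * p)\<^sup>2 \<le> real (card X) * V"
proof -
  define N where "N A = (\<Sum>x\<in>E. of_bool (Q A x) :: real)" for A
  define e where "e = real (card E) * p"
  have cnt: "real (card {A\<in>X. P A}) = (\<Sum>A\<in>X. of_bool (P A))" for P
    using fin by (simp add: Int_def)
  have s1: "(\<Sum>A\<in>X. N A) = e * real (card X)"
  proof -
    have "(\<Sum>A\<in>X. N A) = (\<Sum>x\<in>E. \<Sum>A\<in>X. of_bool (Q A x))"
      unfolding N_def by (rule sum.swap)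
    also have "\<dots> = (\<Sum>x\<in>E. p * real (card X))"
      by (intro sum.cong refl) (metis cnt first)
    finally show ?thesis by (simp add: e_def)
  qed
  have s2: "(\<Sum>A\<in>X. (N A)\<^sup>2) = (\<Sum>x\<in>E. \<Sum>y\<in>E. real (card {A\<in>X. Q A x \<and> Q A y}))"
  proof -
    have "(\<Sum>A\<in>X. (N A)\<^sup>2) = (\<Sum>A\<in>X. \<Sum>x\<in>E. \<Sum>y\<in>E. of_bool (Q A x \<and> Q A y))"
      unfolding N_def power2_eq_square sum_product of_bool_conj ..
    also have "\<dots> = (\<Sum>x\<in>E. \<Sum>A\<in>X. \<Sum>y\<in>E. of_bool (Q A x \<and> Q A y))" by (rule sum.swap)
    also have "\<dots> = (\<Sum>x\<in>E. \<Sum>y\<in>E. \<Sum>A\<in>X. of_bool (Q A x \<and> Q A y))"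
      by (intro sum.cong refl sum.swap)
    finally show ?thesis by (simp only: cnt)
  qed
  have "real (card {A\<in>X. \<forall>x\<in>E. \<not> Q A x}) * e\<^sup>2 = (\<Sum>A\<in>{A\<in>X. \<forall>x\<in>E. \<not> Q A x}. (N A - e)\<^sup>2)"
    by (simp add: N_def)
  also have "\<dots> \<le> (\<Sum>A\<in>X. (N A - e)\<^sup>2)"
    using fin by (intro sum_mono2) auto
  also have "\<dots> = (\<Sum>A\<in>X. (N A)\<^sup>2 - 2 * e * N A + e\<^sup>2)"
    by (intro sum.cong refl) (simp add: power2_diff)
  also have "\<dots> = (\<Sum>A\<in>X. (N A)\<^sup>2) - 2 * e * (\<Sum>A\<in>X. N A) + real (card X) * e\<^sup>2"
    by (simp add: sum.distrib sum_subtractf sum_distrib_left)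
  also have "\<dots> = (\<Sum>A\<in>X. (N A)\<^sup>2) - real (card X) * e\<^sup>2"
    by (simp add: s1 power2_eq_square)
  also have "\<dots> \<le> real (card X) * V"
    using second unfolding s2 e_def by (simp add: algebra_simps)
  finally show ?thesis by (simp add: e_def)
qed

section \<open>The ideal generated by the entries of a message\<close>

text \<open>The unit for convolution; the overloaded \<open>1\<close> on functions is the constant
  function, which is the unit for pointwise multiplication.\<close>

definition galg_one :: "'g::ab_group_add \<Rightarrow> 'f::field" where
  "galg_one = (\<lambda>z. if z = 0 then 1 else 0)"

lemma galg_mult_one_right: "galg_mult b galg_one = (b :: 'g::{ab_group_add,finite} \<Rightarrow> 'f::field)"
proof
  fix z
  have "galg_mult b galg_one z = (\<Sum>x\<in>UNIV. if x = z then b x else 0)"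
    unfolding galg_mult_def galg_one_def by (intro sum.cong) auto
  then show "galg_mult b galg_one z = b z" by simp
qed

lemma galg_mult_one_left: "galg_mult galg_one b = (b :: 'g::{ab_group_add,finite} \<Rightarrow> 'f::field)"
proof
  fix z
  have "galg_mult galg_one b z = (\<Sum>x\<in>(UNIV::'g set). if x = 0 then b z else 0)"
    unfolding galg_mult_def galg_one_def by (intro sum.cong) auto
  then show "galg_mult galg_one b z = b z" by simp
qed

text \<open>One entry of \<open>bA\<close>: the message \<open>b\<close> against a single column
  \<open>a\<close>. Only the first \<open>k\<close> values of either argument enter, so both may be
  arbitrary functions.\<close>

definition comb :: "nat \<Rightarrow> (nat \<Rightarrow> 'g::{ab_group_add,finite} \<Rightarrow> 'f::field) \<Rightarrow> (nat \<Rightarrow> 'g \<Rightarrow> 'f) \<Rightarrow> 'g \<Rightarrow> 'f" where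
  "comb k b a = (\<lambda>z. \<Sum>i<k. galg_mult (b i) (a i) z)"

lemma comb_add_right: "comb k b (a + a') = comb k b a + comb k b a'"
  by (simp add: comb_def galg_mult_def fun_eq_iff sum.distrib ring_distribs)

lemma comb_add_left: "comb k (b + b') a = comb k b a + comb k b' a"
  by (simp add: comb_def galg_mult_def fun_eq_iff sum.distrib ring_distribs)

lemma comb_diff_left: "comb k (b - b') a = comb k b a - comb k b' a"
  by (simp add: comb_def galg_mult_def fun_eq_iff sum_subtractf ring_distribs)

lemma comb_zero_right: "comb k b 0 = 0"
  by (simp add: comb_def galg_mult_def fun_eq_iff)

lemma comb_cong:
  "(\<And>i. i < k \<Longrightarrow> b i = b' i) \<Longrightarrow> (\<And>i. i < k \<Longrightarrow> a i = a' i) \<Longrightarrow> comb k b a = comb k b' a'"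
  by (simp add: comb_def)

lemma comb_single:
  assumes "i < k"
  shows "comb k b (\<lambda>j. if j = i then c else 0) = galg_mult (b i) c"
proof
  fix z
  have "comb k b (\<lambda>j. if j = i then c else 0) z = (\<Sum>j<k. if j = i then galg_mult (b i) c z else 0)"
    unfolding comb_def by (intro sum.cong) (auto simp: galg_mult_def)
  then show "comb k b (\<lambda>j. if j = i then c else 0) z = galg_mult (b i) c z" using assms by simp
qed

text \<open>The ideal generated by the \<open>b i\<close> with \<open>i < k\<close>: the column is
  arbitrary, so all \<open>FG\<close>-linear combinations occur.\<close>

definition comb_ideal :: "nat \<Rightarrow> (nat \<Rightarrow> 'g::{ab_group_add,finite} \<Rightarrow> 'f::field) \<Rightarrow> ('g \<Rightarrow> 'f) set" where
  "comb_ideal k b = range (comb k b)"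

lemma shift_subspace_comb_ideal: "shift_subspace (comb_ideal k b)"
  unfolding shift_subspace_def
proof (intro conjI ballI allI)
  show "0 \<in> comb_ideal k b" unfolding comb_ideal_def by (metis comb_zero_right rangeI)
next
  fix x y assume "x \<in> comb_ideal k b" "y \<in> comb_ideal k b"
  then obtain a a' where "x = comb k b a" "y = comb k b a'" by (auto simp: comb_ideal_def)
  then have "x + y = comb k b (a + a')" by (simp add: comb_add_right)
  then show "x + y \<in> comb_ideal k b" by (auto simp: comb_ideal_def)
next
  fix c x assume "x \<in> comb_ideal k b"
  then obtain a where "x = comb k b a" by (auto simp: comb_ideal_def)
  then have "(\<lambda>z. c * x z) = comb k b (\<lambda>i z. c * a i z)"
    by (simp add: comb_def galg_mult_def fun_eq_iff sum_distrib_left mult_ac)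
  then show "(\<lambda>z. c * x z) \<in> comb_ideal k b" by (auto simp: comb_ideal_def)
next
  fix g x assume "x \<in> comb_ideal k b"
  then obtain a where "x = comb k b a" by (auto simp: comb_ideal_def)
  then have "(\<lambda>z. x (z - g)) = comb k b (\<lambda>i z. a i (z - g))"
    by (simp add: comb_def galg_mult_def fun_eq_iff algebra_simps)
  then show "(\<lambda>z. x (z - g)) \<in> comb_ideal k b" by (auto simp: comb_ideal_def)
qed

lemma comb_ideal_nonempty [simp]: "comb_ideal k b \<noteq> {}"
  by (simp add: comb_ideal_def)

text \<open>Limits the number of messages with a given ideal: a message generating \<open>J\<close>
  has its entries in \<open>J\<close>.\<close>

lemma coeff_in_comb_ideal:
  assumes "i < k"
  shows "b i \<in> comb_ideal k b"
proof -
  have "b i = comb k b (\<lambda>j. if j = i then galg_one else 0)"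
    using assms by (simp only: comb_single galg_mult_one_right)
  then show ?thesis unfolding comb_ideal_def by blast
qed

section \<open>Distribution of one and of two codewords\<close>

abbreviation matrices :: "nat \<Rightarrow> nat \<Rightarrow> (nat \<times> nat \<Rightarrow> 'g::{ab_group_add,finite} \<Rightarrow> 'f::{field,finite}) set" where
  "matrices k n \<equiv> zext ({..<k} \<times> {..<n}) UNIV"

definition encode :: "nat \<Rightarrow> (nat \<Rightarrow> 'g::{ab_group_add,finite} \<Rightarrow> 'f::field)
    \<Rightarrow> (nat \<times> nat \<Rightarrow> 'g \<Rightarrow> 'f) \<Rightarrow> nat \<Rightarrow> 'g \<Rightarrow> 'f" where
  "encode k b A = (\<lambda>j. comb k b (\<lambda>i. A (i, j)))"

lemma encode_add: "encode k b (A + A') = encode k b A + encode k b A'"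
proof
  fix j
  have "(\<lambda>i. (A + A') (i, j)) = (\<lambda>i. A (i, j)) + (\<lambda>i. A' (i, j))" by (simp add: fun_eq_iff)
  then show "encode k b (A + A') j = (encode k b A + encode k b A') j"
    by (simp only: encode_def comb_add_right plus_fun_apply)
qed

lemma encode_outside: "A \<in> matrices k n \<Longrightarrow> \<not> j < n \<Longrightarrow> encode k b A j = 0"
  by (auto simp: encode_def comb_def zext_def galg_mult_def fun_eq_iff)

text \<open>The columns of \<open>A\<close> can be chosen independently, so every
  \<open>n\<close>-tuple from the ideal is attained.\<close>

lemma encode_image: "encode k b ` matrices k n = zext {..<n} (comb_ideal k b)"
proof (intro equalityI subsetI)
  fix w assume "w \<in> encode k b ` matrices k n"
  then obtain A where A: "A \<in> matrices k n" "w = encode k b A" by blast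
  have "encode k b A j \<in> comb_ideal k b" for j by (simp add: comb_ideal_def encode_def)
  then show "w \<in> zext {..<n} (comb_ideal k b)"
    using encode_outside[OF A(1)] by (simp add: zext_def A(2))
next
  fix w assume w: "w \<in> zext {..<n} (comb_ideal k b)"
  then have "\<forall>j<n. \<exists>a. w j = comb k b a" by (auto simp: zext_def comb_ideal_def)
  then obtain a where a: "\<And>j. j < n \<Longrightarrow> w j = comb k b (a j)" by metis
  define A where "A = (\<lambda>(i, j). if i < k \<and> j < n then a j i else 0)"
  have A: "A \<in> matrices k n" by (auto simp: A_def zext_def)
  have "w = encode k b A"
  proof
    fix j show "w j = encode k b A j"
    proof (cases "j < n")
      case True
      then show ?thesis by (simp add: a encode_def A_def cong: comb_cong)
    next
      case False
      then show ?thesis using w encode_outside[OF A False] by (simp add: zext_def)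
    qed
  qed
  then show "w \<in> encode k b ` matrices k n" using A by blast
qed

text \<open>Uniformity of \<open>bA\<close> on \<open>J^n\<close>: the map from \<open>A\<close> to
  \<open>bA\<close> is additive with image \<open>J^n\<close>, so
  \<open>card_additive_preimage\<close> applies.\<close>

lemma card_encode_in:
  fixes b :: "nat \<Rightarrow> 'g::{ab_group_add,finite} \<Rightarrow> 'f::{field,finite}"
  shows "real (card {A\<in>matrices k n. encode k b A \<in> T})
    = real (card (matrices k n :: (nat \<times> nat \<Rightarrow> 'g \<Rightarrow> 'f) set))
      * real (card (T \<inter> zext {..<n} (comb_ideal k b))) / real (card (comb_ideal k b)) ^ n"
proof -
  let ?J = "comb_ideal k b"
  have "card {A\<in>matrices k n. encode k b A \<in> T} * card (encode k b ` matrices k n)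
      = card (T \<inter> encode k b ` matrices k n) * card (matrices k n :: (nat \<times> nat \<Rightarrow> 'g \<Rightarrow> 'f) set)"
    by (intro card_additive_preimage zext_add zext_diff encode_add) (auto simp: finite_zext)
  then have "real (card {A\<in>matrices k n. encode k b A \<in> T}) * real (card ?J) ^ n
      = real (card (T \<inter> zext {..<n} ?J)) * real (card (matrices k n :: (nat \<times> nat \<Rightarrow> 'g \<Rightarrow> 'f) set))"
    unfolding encode_image by (simp add: card_zext flip: of_nat_mult of_nat_power)
  then show ?thesis by (simp add: nonzero_eq_divide_eq mult_ac)
qed

text \<open>The pairs \<open>(u, v)\<close> record a codeword \<open>u\<close> and its difference \<open>v\<close> to the other codeword.\<close>

lemma card_encode_pair_in:
  fixes x x' :: "nat \<Rightarrow> 'g::{ab_group_add,finite} \<Rightarrow> 'f::{field,finite}"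
  defines "e \<equiv> (\<lambda>i. if i = 0 then galg_one else 0) :: nat \<Rightarrow> 'g \<Rightarrow> 'f"
  assumes k: "k > 0" and x: "x 0 = 0" "x' 0 = 0"
  shows "real (card {A\<in>matrices k n. encode k (e + x) A \<in> T \<and> encode k (e + x') A \<in> T'})
    = real (card (matrices k n :: (nat \<times> nat \<Rightarrow> 'g \<Rightarrow> 'f) set))
      * real (card {(u, v). u \<in> T \<inter> zext {..<n} UNIV \<and> u + v \<in> T' \<and> v \<in> zext {..<n} (comb_ideal k (x' - x))})
      / (real (CARD('g \<Rightarrow> 'f)) ^ n * real (card (comb_ideal k (x' - x))) ^ n)"
proof -
  let ?J = "comb_ideal k (x' - x)" and ?M = "matrices k n :: (nat \<times> nat \<Rightarrow> 'g \<Rightarrow> 'f) set"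
  define \<phi> where "\<phi> A = (encode k (e + x) A, encode k (x' - x) A)" for A :: "nat \<times> nat \<Rightarrow> 'g \<Rightarrow> 'f"
  let ?U = "zext {..<n} UNIV :: (nat \<Rightarrow> 'g \<Rightarrow> 'f) set"
  have img: "\<phi> ` ?M = ?U \<times> zext {..<n} ?J"
  proof (intro equalityI subsetI)
    fix p assume "p \<in> \<phi> ` ?M"
    then obtain A where A: "A \<in> ?M" "p = \<phi> A" by blast
    have "encode k (x' - x) A \<in> zext {..<n} ?J" using encode_image A by blast
    moreover have "encode k (e + x) A \<in> ?U" using encode_outside[OF A(1)] by (auto simp: zext_def)
    ultimately show "p \<in> ?U \<times> zext {..<n} ?J" by (simp add: A \<phi>_def)
  next
    fix p assume "p \<in> ?U \<times> zext {..<n} ?J"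
    then obtain u v where p: "p = (u, v)" "u \<in> ?U" "v \<in> zext {..<n} ?J" by auto
    then obtain A where A: "A \<in> ?M" "v = encode k (x' - x) A" using encode_image by blast
    \<comment> \<open>Row 0 has coefficient 1 in \<open>e + x\<close> and 0 in
      \<open>x' - x\<close>. Adding \<open>D\<close> to that row therefore moves the first component
      to \<open>u\<close> and leaves the second equal to \<open>v\<close>.\<close>
    define D where "D = u - encode k (e + x) A"
    define A' where "A' = A + (\<lambda>(i, j). if i = 0 then D j else 0)"
    have col: "(\<lambda>i. A' (i, j)) = (\<lambda>i. A (i, j)) + (\<lambda>i. if i = 0 then D j else 0)" for j
      by (auto simp: A'_def fun_eq_iff)
    have "D j = 0" if "\<not> j < n" for j
      using p(2) encode_outside[OF A(1) that] that by (simp add: D_def zext_def)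
    then have "A' \<in> ?M"
      using k A(1) by (auto simp: zext_def A'_def)
    moreover have "encode k (x' - x) A' = v"
    proof
      fix j
      have "encode k (x' - x) A' j = encode k (x' - x) A j + galg_mult ((x' - x) 0) (D j)"
        unfolding encode_def col comb_add_right using k by (simp only: comb_single)
      also have "galg_mult ((x' - x) 0) (D j) = 0" by (simp add: x galg_mult_def fun_eq_iff)
      finally show "encode k (x' - x) A' j = v j" by (simp only: A add_0_right)
    qed
    moreover have "encode k (e + x) A' = u"
    proof
      fix j
      have "encode k (e + x) A' j = encode k (e + x) A j + galg_mult ((e + x) 0) (D j)"
        unfolding encode_def col comb_add_right using k by (simp only: comb_single)
      also have "galg_mult ((e + x) 0) (D j) = D j" by (simp add: x e_def galg_mult_one_left)
      also have "D j = u j - encode k (e + x) A j" unfolding D_def by (rule fun_diff_def[THEN fun_cong])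
      finally show "encode k (e + x) A' j = u j" by (simp only: add_diff_eq add_diff_cancel_left')
    qed
    ultimately have "p = \<phi> A'" by (simp add: p \<phi>_def)
    then show "p \<in> \<phi> ` ?M" using \<open>A' \<in> ?M\<close> by blast
  qed
  define S where "S = {(u, v). u \<in> T \<and> u + v \<in> T'}"
  have "{A\<in>?M. encode k (e + x) A \<in> T \<and> encode k (e + x') A \<in> T'} = {A\<in>?M. \<phi> A \<in> S}"
  proof -
    have "encode k (e + x') A = encode k (e + x) A + encode k (x' - x) A" for A
      by (simp add: encode_def fun_eq_iff comb_add_left comb_diff_left)
    then show ?thesis by (simp add: \<phi>_def S_def)
  qed
  moreover have "card {A\<in>?M. \<phi> A \<in> S} * card (\<phi> ` ?M) = card (S \<inter> \<phi> ` ?M) * card ?M"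
    by (intro card_additive_preimage zext_add zext_diff) (auto simp: finite_zext \<phi>_def encode_add)
  moreover have "S \<inter> \<phi> ` ?M
      = {(u, v). u \<in> T \<inter> zext {..<n} UNIV \<and> u + v \<in> T' \<and> v \<in> zext {..<n} ?J}"
    unfolding img S_def by auto
  moreover have "card (\<phi> ` ?M) = CARD('g \<Rightarrow> 'f) ^ n * card ?J ^ n"
    unfolding img by (simp only: card_cartesian_product card_zext finite_lessThan card_lessThan)
  ultimately have "card {A\<in>?M. encode k (e + x) A \<in> T \<and> encode k (e + x') A \<in> T'}
      * (CARD('g \<Rightarrow> 'f) ^ n * card ?J ^ n)
    = card {(u, v). u \<in> T \<inter> zext {..<n} UNIV \<and> u + v \<in> T' \<and> v \<in> zext {..<n} ?J} * card ?M"
    by (simp only:)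
  then have "real (card {A\<in>?M. encode k (e + x) A \<in> T \<and> encode k (e + x') A \<in> T'})
      * (real (CARD('g \<Rightarrow> 'f)) ^ n * real (card ?J) ^ n)
    = real (card {(u, v). u \<in> T \<inter> zext {..<n} UNIV \<and> u + v \<in> T' \<and> v \<in> zext {..<n} ?J}) * real (card ?M)"
    by (simp only: of_nat_mult[symmetric] of_nat_power[symmetric])
  moreover have "CARD('g \<Rightarrow> 'f) > 0" by (simp only: zero_less_card_finite)
  ultimately show ?thesis by (simp add: nonzero_eq_divide_eq mult_ac)
qed

section \<open>The volume of Hamming spheres\<close>

text \<open>These are the terms in the expansion of \<open>(t + (N - t)) ^ N\<close>. Successive
  ones have ratio \<open>(N - i) * t / (Suc i * (N - t))\<close>, which is at least 1 for
  \<open>i < t\<close> and at most 1 for \<open>t \<le> i\<close>.\<close>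

lemma binomial_term_le_mode:
  fixes N t i :: nat
  assumes t: "t < N" and i: "i \<le> N"
  defines "T \<equiv> \<lambda>i. (N choose i) * t ^ i * (N - t) ^ (N - i)"
  shows "T i \<le> T t"
proof -
  have rel: "Suc i * (N - t) * T (Suc i) = (N - i) * t * T i" if "i < N" for i
  proof -
    have pow: "(N - t) ^ (N - i) = (N - t) * (N - t) ^ (N - Suc i)"
      using that by (metis Suc_diff_Suc power_Suc)
    have "Suc i * (N choose Suc i) = (N - i) * (N choose i)"
      by (simp only: binomial_absorb_comp binomial_absorption)
    then have "(Suc i * (N choose Suc i)) * (t ^ Suc i * ((N - t) * (N - t) ^ (N - Suc i)))
        = ((N - i) * (N choose i)) * (t ^ Suc i * ((N - t) * (N - t) ^ (N - Suc i)))" by simp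
    then show ?thesis unfolding T_def pow by (simp only: power_Suc mult_ac)
  qed
  have up: "T i \<le> T (Suc i)" if "i < t" for i
  proof -
    have "Suc i * (N - t) \<le> t * (N - i)" using that t by (intro mult_le_mono) auto
    then have "Suc i * (N - t) * T i \<le> (N - i) * t * T i"
      by (intro mult_le_mono1) (simp only: mult.commute)
    also have "\<dots> = Suc i * (N - t) * T (Suc i)" using rel[of i] that t by simp
    finally show ?thesis using t by (simp only: mult_le_cancel1) auto
  qed
  have down: "T (Suc i) \<le> T i" if "t \<le> i" "i < N" for i
  proof -
    have "(N - i) * t \<le> (N - t) * Suc i" using that t by (intro mult_le_mono) auto
    then have "(N - i) * t * T i \<le> Suc i * (N - t) * T i"
      by (intro mult_le_mono1) (simp only: mult.commute)
    then have "Suc i * (N - t) * T (Suc i) \<le> Suc i * (N - t) * T i" using rel[of i] that by simp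
    then show ?thesis using t by (simp only: mult_le_cancel1) auto
  qed
  show ?thesis
  proof (cases "i \<le> t")
    case True
    then show ?thesis by (induction rule: inc_induct) (use up le_trans in blast)+
  next
    case False
    then have "t \<le> i" by simp
    then show ?thesis using i
    proof (induction rule: dec_induct)
      case (step j)
      then show ?case using down[of j] by simp
    qed simp
  qed
qed

text \<open>By logarithms the left side is
  \<open>(q - 1) ^ t * N ^ N / (t ^ t * (N - t) ^ (N - t))\<close>. Expanding \<open>N ^ N\<close>
  into \<open>N + 1\<close> binomial terms and bounding each by the one at \<open>t\<close> gives
  the claim.\<close>

lemma powr_hq_le_binomial:
  fixes q :: real
  assumes q: "q > 1" and t: "0 < t" "t < N"
  shows "q powr (real N * hq q (real t / real N)) \<le> (real N + 1) * (real (N choose t) * (q - 1) ^ t)"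
proof -
  define E where "E = real t ^ t * real (N - t) ^ (N - t)"
  have E: "E > 0" using t by (simp add: E_def)
  have p: "0 < real t / real N" "real t / real N < 1" using t by auto
  have p1: "1 - real t / real N = real (N - t) / real N" using t by (simp add: of_nat_diff field_simps)
  have "ln (q powr (real N * hq q (real t / real N)) * E) = ln ((q - 1) ^ t * real N ^ N)"
  proof -
    have "ln (q powr (real N * hq q (real t / real N)))
        = real N * (real t / real N * ln (q - 1) - real t / real N * ln (real t / real N)
          - (1 - real t / real N) * ln (1 - real t / real N))"
      using p q by (simp add: hq_def xlogx_def log_def ln_powr field_simps)
    also have "\<dots> = real t * ln (q - 1) - real t * (ln t - ln N) - real (N - t) * (ln (N - t) - ln N)"
      unfolding p1 using t by (simp add: ln_div right_diff_distrib)
    finally have 1: "ln (q powr (real N * hq q (real t / real N)))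
        = real t * ln (q - 1) - real t * (ln t - ln N) - real (N - t) * (ln (N - t) - ln N)" .
    have 2: "ln E = real t * ln t + real (N - t) * ln (N - t)"
      using t by (simp add: E_def ln_mult ln_realpow)
    have 3: "ln ((q - 1) ^ t * real N ^ N) = real t * ln (q - 1) + real N * ln N"
      using t q by (simp add: ln_mult ln_realpow)
    have "ln (q powr (real N * hq q (real t / real N)) * E)
        = ln (q powr (real N * hq q (real t / real N))) + ln E"
      using q E by (subst ln_mult) auto
    then show ?thesis unfolding 1 2 3 using t by (simp add: of_nat_diff algebra_simps)
  qed
  then have eq: "q powr (real N * hq q (real t / real N)) * E = (q - 1) ^ t * real N ^ N"
    using q t E by (subst (asm) ln_inj_iff) auto
  have "N ^ N = (t + (N - t)) ^ N" using t by simp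
  also have "\<dots> = (\<Sum>i\<le>N. (N choose i) * t ^ i * (N - t) ^ (N - i))" by (simp add: binomial)
  also have "\<dots> \<le> (\<Sum>i\<le>N. (N choose t) * t ^ t * (N - t) ^ (N - t))"
    using t by (intro sum_mono binomial_term_le_mode) auto
  finally have "N ^ N \<le> (N + 1) * ((N choose t) * t ^ t * (N - t) ^ (N - t))" by simp
  then have "real (N ^ N) \<le> real ((N + 1) * ((N choose t) * t ^ t * (N - t) ^ (N - t)))"
    by (rule of_nat_mono)
  then have "real N ^ N \<le> (real N + 1) * real (N choose t) * E"
    by (simp add: E_def algebra_simps)
  then have "(q - 1) ^ t * real N ^ N \<le> (q - 1) ^ t * ((real N + 1) * real (N choose t) * E)"
    using q by (intro mult_left_mono) auto
  then have "q powr (real N * hq q (real t / real N)) * E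
      \<le> ((real N + 1) * (real (N choose t) * (q - 1) ^ t)) * E"
    unfolding eq by (simp add: mult_ac)
  then show ?thesis using E by simp
qed

lemma isCont_hq:
  assumes "q > 1" "0 < \<delta>" "\<delta> < 1"
  shows "isCont (hq q) \<delta>"
proof -
  have "continuous_on {0<..<1} (\<lambda>x. x * log q (q - 1) - x * log q x - (1 - x) * log q (1 - x))"
    using assms by (intro continuous_intros) auto
  then have "continuous_on {0<..<1} (hq q)"
    by (rule continuous_on_eq) (auto simp: hq_def xlogx_def)
  then show ?thesis using assms by (simp add: continuous_on_eq_continuous_at)
qed

text \<open>Rounding \<open>\<delta> * N\<close> down to an integer costs half of \<epsilon>, by
  continuity of \<open>hq q\<close>, and the factor \<open>N + 1\<close> costs the other half.
  Positivity of the radius will exclude the zero word.\<close>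

lemma eventually_powr_hq_le_binomial:
  fixes q \<delta> \<epsilon> :: real
  assumes q: "q > 1" and \<delta>: "0 < \<delta>" "\<delta> < 1" and \<epsilon>: "\<epsilon> > 0"
  shows "\<forall>\<^sub>F N in sequentially. 0 < nat \<lfloor>\<delta> * real N\<rfloor> \<and>
    q powr (real N * (hq q \<delta> - \<epsilon>)) \<le> real (N choose nat \<lfloor>\<delta> * real N\<rfloor>) * (q - 1) ^ nat \<lfloor>\<delta> * real N\<rfloor>"
proof -
  define t where "t N = nat \<lfloor>\<delta> * real N\<rfloor>" for N
  have t: "real (t N) \<le> \<delta> * real N" "\<delta> * real N - 1 \<le> real (t N)" for N
    unfolding t_def using \<delta> by (auto simp: of_nat_floor)
  have lim: "(\<lambda>N. real (t N) / real N) \<longlonglongrightarrow> \<delta>"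
  proof (rule tendsto_sandwich[where f = "\<lambda>N. \<delta> - 1 / real N" and h = "\<lambda>_. \<delta>"])
    show "\<forall>\<^sub>F N in sequentially. \<delta> - 1 / real N \<le> real (t N) / real N"
      using eventually_gt_at_top[of 0]
    proof eventually_elim
      case (elim N)
      have "(\<delta> * real N - 1) / real N \<le> real (t N) / real N" using t by (intro divide_right_mono) auto
      then show ?case using elim by (simp add: diff_divide_distrib)
    qed
    show "\<forall>\<^sub>F N in sequentially. real (t N) / real N \<le> \<delta>"
      using eventually_gt_at_top[of 0] by eventually_elim (use t in \<open>simp add: field_simps\<close>)
    show "(\<lambda>N. \<delta> - 1 / real N) \<longlonglongrightarrow> \<delta>" by real_asymp
  qed auto
  have h: "(\<lambda>N. hq q (real (t N) / real N)) \<longlonglongrightarrow> hq q \<delta>"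
    using isCont_tendsto_compose[OF isCont_hq lim] q \<delta> by blast
  have 1: "\<forall>\<^sub>F N in sequentially. hq q \<delta> - \<epsilon> / 2 < hq q (real (t N) / real N)"
    using order_tendstoD(1)[OF h, of "hq q \<delta> - \<epsilon> / 2"] \<epsilon> by simp
  have 2: "\<forall>\<^sub>F N in sequentially. real N + 1 \<le> q powr (real N * (\<epsilon> / 2))"
  proof -
    define c where "c = ln q * (\<epsilon> / 2)"
    have "c > 0" using q \<epsilon> by (simp add: c_def)
    then have "\<forall>\<^sub>F N in sequentially. real N + 1 \<le> exp (c * real N)" by real_asymp
    then show ?thesis using q by (simp add: powr_def c_def mult_ac)
  qed
  have 3: "\<forall>\<^sub>F N in sequentially. 1 < \<delta> * real N" using \<delta> by real_asymp
  show ?thesis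
    unfolding t_def[symmetric] using 1 2 3 eventually_gt_at_top[of 0]
  proof eventually_elim
    case (elim N)
    have tp: "0 < t N" using t(2)[of N] elim(3) by linarith
    have "\<delta> * real N < real N" using \<delta> elim(4) by simp
    then have tN: "t N < N" using t(1)[of N] by linarith
    have "(real N + 1) * q powr (real N * (hq q \<delta> - \<epsilon>))
        \<le> q powr (real N * (\<epsilon> / 2)) * q powr (real N * (hq q \<delta> - \<epsilon>))"
      using elim(2) by (intro mult_right_mono) auto
    also have "\<dots> = q powr (real N * (hq q \<delta> - \<epsilon> / 2))"
      by (simp add: powr_add[symmetric] algebra_simps)
    also have "\<dots> \<le> q powr (real N * hq q (real (t N) / real N))"
      using q elim(1) by (intro powr_mono mult_left_mono) auto
    also have "\<dots> \<le> (real N + 1) * (real (N choose t N) * (q - 1) ^ t N)"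
      using powr_hq_le_binomial q tp tN by blast
    finally have "q powr (real N * (hq q \<delta> - \<epsilon>)) \<le> real (N choose t N) * (q - 1) ^ t N"
      by (rule mult_left_le_imp_le) simp
    then show ?case using tp by blast
  qed
qed

text \<open>A word of weight \<open>t\<close> is given by its support among the
  \<open>CARD('g) * n\<close> positions and nonzero values there; injecting such pairs into the
  sphere suffices for a lower bound.\<close>

lemma card_sphere_ge:
  fixes n t :: nat
  shows "real (CARD('g::finite) * n choose t) * (real CARD('f::{field,finite}) - 1) ^ t
    \<le> real (card {v\<in>zext {..<n} (UNIV :: ('g \<Rightarrow> 'f) set). word_weight n v = t})"
proof -
  let ?D = "{..<n} \<times> (UNIV :: 'g set)"
  let ?P = "SIGMA S:{S. S \<subseteq> ?D \<and> card S = t}. S \<rightarrow>\<^sub>E (UNIV - {0 :: 'f})"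
  let ?B = "{v\<in>zext {..<n} (UNIV :: ('g \<Rightarrow> 'f) set). word_weight n v = t}"
  define \<rho> where "\<rho> = (\<lambda>(S, f) (j::nat) (z::'g). if (j, z) \<in> S then f (j, z) else (0 :: 'f))"
  have "finite ?B" by (simp add: finite_zext)
  moreover have supp: "{(j, z). \<rho> (S, f) j z \<noteq> 0} = S" if "(S, f) \<in> ?P" for S f
    using that by (auto simp: \<rho>_def PiE_def Pi_def split: if_splits)
  have "inj_on \<rho> ?P"
  proof (rule inj_onI)
    fix a b assume ab: "a \<in> ?P" "b \<in> ?P" "\<rho> a = \<rho> b"
    obtain S f S' f' where [simp]: "a = (S, f)" "b = (S', f')" by fastforce
    have S: "S = S'" using supp[of S f] supp[of S' f'] ab by (simp only: \<open>a = (S, f)\<close> \<open>b = (S', f')\<close>)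
    have "f x = f' x" for x
    proof (cases "x \<in> S")
      case True
      then show ?thesis using fun_cong[OF fun_cong[OF ab(3), of "fst x"], of "snd x"] S by (simp add: \<rho>_def)
    next
      case False
      then show ?thesis using ab(1,2) S by (cases x) (auto simp: PiE_def extensional_def)
    qed
    then show "a = b" using S by auto
  qed
  moreover have "\<rho> ` ?P \<subseteq> ?B"
  proof
    fix v assume "v \<in> \<rho> ` ?P"
    then obtain S f where v: "v = \<rho> (S, f)" and P: "(S, f) \<in> ?P" by auto
    have S: "S \<subseteq> ?D" "card S = t" using P by auto
    have "word_weight n v = card (SIGMA j:{..<n}. {z. v j z \<noteq> 0})"
      by (simp add: word_weight_def galg_weight_def)
    also have "(SIGMA j:{..<n}. {z. v j z \<noteq> 0}) = S"
      using supp[OF P] S(1) unfolding v by auto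
    finally have "word_weight n v = t" using S by simp
    moreover have "v \<in> zext {..<n} UNIV"
      using S(1) by (auto simp: v \<rho>_def zext_def fun_eq_iff)
    ultimately show "v \<in> ?B" by simp
  qed
  ultimately have "card ?P \<le> card ?B" by (intro card_inj_on_le)
  moreover have "card ?P = (\<Sum>S\<in>{S. S \<subseteq> ?D \<and> card S = t}. card (S \<rightarrow>\<^sub>E (UNIV - {0 :: 'f})))"
  proof (rule card_SigmaI)
    show "finite {S. S \<subseteq> ?D \<and> card S = t}"
      by (rule finite_subset[of _ "Pow ?D"]) auto
    show "\<forall>S\<in>{S. S \<subseteq> ?D \<and> card S = t}. finite (S \<rightarrow>\<^sub>E (UNIV - {0 :: 'f}))"
    proof
      fix S assume "S \<in> {S. S \<subseteq> ?D \<and> card S = t}"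
      then have "finite S" using finite_subset[of S ?D] by auto
      then show "finite (S \<rightarrow>\<^sub>E (UNIV - {0 :: 'f}))" by (intro finite_PiE) auto
    qed
  qed
  moreover have "\<dots> = (\<Sum>S\<in>{S. S \<subseteq> ?D \<and> card S = t}. (CARD('f) - 1) ^ t)"
  proof (rule sum.cong[OF refl])
    fix S assume S: "S \<in> {S. S \<subseteq> ?D \<and> card S = t}"
    then have "finite S" using finite_subset[of S ?D] by auto
    then show "card (S \<rightarrow>\<^sub>E (UNIV - {0 :: 'f})) = (CARD('f) - 1) ^ t"
      using S by (simp add: card_PiE card_Diff_singleton)
  qed
  moreover have "\<dots> = (CARD('g) * n choose t) * (CARD('f) - 1) ^ t"
    by (simp add: n_subsets card_cartesian_product mult.commute)
  ultimately have "(CARD('g) * n choose t) * (CARD('f) - 1) ^ t \<le> card ?B" by (simp only:)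
  then have "real ((CARD('g) * n choose t) * (CARD('f) - 1) ^ t) \<le> real (card ?B)"
    by (rule of_nat_mono)
  moreover have "real (CARD('f) - 1) = real CARD('f) - 1"
    using card_field_ge_2[where 'f='f] by (simp add: of_nat_diff)
  ultimately show ?thesis by simp
qed

section \<open>The threshold\<close>

text \<open>The infimum over a nonempty set of naturals is attained. For the zero code the distance
  is infinite and the right side is vacuous, so both sides hold.\<close>

lemma rel_distance_gt_iff:
  fixes C :: "(nat \<Rightarrow> 'g::finite \<Rightarrow> 'f::zero) set"
  assumes n: "n > 0"
  shows "rel_distance n C > ereal \<delta> \<longleftrightarrow>
    (\<forall>c\<in>C. (\<exists>j<n. c j \<noteq> 0) \<longrightarrow> \<delta> * (real CARD('g) * real n) < real (word_weight n c))"
proof -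
  define S where "S = {c\<in>C. \<exists>j<n. \<exists>z. c j z \<noteq> 0}"
  have mn: "real CARD('g) * real n > 0" using n by simp
  have S: "(\<forall>c\<in>C. (\<exists>j<n. c j \<noteq> 0) \<longrightarrow> P c) \<longleftrightarrow> (\<forall>c\<in>S. P c)" for P
    by (auto simp: S_def fun_eq_iff)
  have mw: "min_weight n C = (INF c\<in>S. enat (word_weight n c))" by (simp add: min_weight_def S_def)
  show ?thesis
  proof (cases "S = {}")
    case True
    then have "min_weight n C = \<infinity>" by (simp add: mw top_enat_def)
    then show ?thesis unfolding S using True by (simp add: rel_distance_def)
  next
    case False
    then obtain c where c: "c \<in> S" "\<And>c'. c' \<in> S \<Longrightarrow> word_weight n c \<le> word_weight n c'"
      using ex_has_least_nat[of "\<lambda>c. c \<in> S" _ "word_weight n"] by blast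
    have "min_weight n C = enat (word_weight n c)"
      unfolding mw by (intro antisym INF_lower INF_greatest) (use c in auto)
    then have "rel_distance n C > ereal \<delta> \<longleftrightarrow> \<delta> * (real CARD('g) * real n) < real (word_weight n c)"
      using mn by (simp add: rel_distance_def pos_less_divide_eq)
    also have "\<dots> \<longleftrightarrow> (\<forall>c\<in>S. \<delta> * (real CARD('g) * real n) < real (word_weight n c))"
      using c by (meson less_le_trans of_nat_mono)
    finally show ?thesis unfolding S .
  qed
qed

text \<open>The event that the relative distance exceeds \<delta>, phrased with messages instead of
  codewords. \<open>b\<close> is unrestricted because only its first \<open>k\<close> values enter;
  messages encoded as the zero word are exempt, even nonzero ones.\<close>

definition good_matrices :: "real \<Rightarrow> nat \<Rightarrow> nat \<Rightarrow> (nat \<times> nat \<Rightarrow> 'g::{ab_group_add,finite} \<Rightarrow> 'f::{field,finite}) set" where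
  "good_matrices \<delta> k n = {A\<in>matrices k n. \<forall>b. (\<exists>j<n. encode k b A j \<noteq> 0) \<longrightarrow>
     \<delta> * (real CARD('g) * real n) < real (word_weight n (encode k b A))}"

text \<open>The sample space of the definition and \<open>matrices k n\<close> differ only in the
  default value outside the index range, so \<open>restrict\<close> carries one event onto the
  other.\<close>

lemma prob_dist_gt_eq:
  fixes r \<delta> :: real
  assumes n: "n > 0"
  defines "k \<equiv> nat (round (r * real n))"
  shows "prob_dist_gt TYPE('f::{field,finite}) TYPE('g::{ab_group_add,finite}) r \<delta> n
    = real (card (good_matrices \<delta> k n :: (nat \<times> nat \<Rightarrow> 'g \<Rightarrow> 'f) set))
      / real (card (matrices k n :: (nat \<times> nat \<Rightarrow> 'g \<Rightarrow> 'f) set))"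
proof -
  let ?S = "{..<k} \<times> {..<n}"
  let ?PE = "?S \<rightarrow>\<^sub>E (UNIV :: ('g \<Rightarrow> 'f) set)"
  let ?M = "matrices k n :: (nat \<times> nat \<Rightarrow> 'g \<Rightarrow> 'f) set"
  have iff: "rel_distance n (code_of k n (restrict A ?S)) > ereal \<delta> \<longleftrightarrow> A \<in> good_matrices \<delta> k n"
    if A: "A \<in> ?M" for A
  proof -
    let ?P = "\<lambda>c. (\<exists>j<n. c j \<noteq> 0) \<longrightarrow> \<delta> * (real CARD('g) * real n) < real (word_weight n c)"
    have word: "(\<lambda>j\<in>{..<n}. \<lambda>z. \<Sum>i<k. galg_mult (b i) (restrict A ?S (i, j)) z)
        = restrict (encode k b A) {..<n}" for b
      by (auto simp: encode_def comb_def fun_eq_iff)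
    have P: "?P (restrict w {..<n}) \<longleftrightarrow> ?P w" for w :: "nat \<Rightarrow> 'g \<Rightarrow> 'f"
      by (auto simp: word_weight_def)
    have "rel_distance n (code_of k n (restrict A ?S)) > ereal \<delta>
        \<longleftrightarrow> (\<forall>b\<in>{..<k} \<rightarrow>\<^sub>E UNIV. ?P (restrict (encode k b A) {..<n}))"
      unfolding rel_distance_gt_iff[OF n] code_of_def word by blast
    also have "\<dots> \<longleftrightarrow> (\<forall>b\<in>{..<k} \<rightarrow>\<^sub>E UNIV. ?P (encode k b A))"
      unfolding P ..
    also have "\<dots> \<longleftrightarrow> (\<forall>b. ?P (encode k b A))"
    proof (intro iffI allI ballI)
      fix b assume H: "\<forall>b\<in>{..<k} \<rightarrow>\<^sub>E UNIV. ?P (encode k b A)"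
      have "encode k (restrict b {..<k}) A = encode k b A"
        unfolding encode_def by (intro ext fun_cong[OF comb_cong]) auto
      moreover have "restrict b {..<k} \<in> {..<k} \<rightarrow>\<^sub>E UNIV" by auto
      ultimately show "?P (encode k b A)" using H by metis
    qed blast
    finally show ?thesis using A by (simp add: good_matrices_def)
  qed
  have bij: "bij_betw (\<lambda>A. restrict A ?S) ?M ?PE" by (rule bij_betw_zext_PiE)
  have "(\<lambda>A. restrict A ?S) ` (good_matrices \<delta> k n :: (nat \<times> nat \<Rightarrow> 'g \<Rightarrow> 'f) set)
      = {A\<in>?PE. rel_distance n (code_of k n A) > ereal \<delta>}" (is "?L = ?R")
  proof (intro equalityI subsetI)
    fix A assume "A \<in> ?L"
    then obtain A' where A': "A' \<in> good_matrices \<delta> k n" "A = restrict A' ?S" by blast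
    then have "A' \<in> ?M" by (simp add: good_matrices_def)
    then show "A \<in> ?R" using iff A' bij_betw_apply[OF bij] by simp
  next
    fix A assume A: "A \<in> ?R"
    then obtain A' where "A' \<in> ?M" "A = restrict A' ?S"
      using bij unfolding bij_betw_def by blast
    then show "A \<in> ?L" using iff A by blast
  qed
  moreover have "inj_on (\<lambda>A. restrict A ?S) (good_matrices \<delta> k n :: (nat \<times> nat \<Rightarrow> 'g \<Rightarrow> 'f) set)"
    by (rule inj_on_subset[OF bij_betw_imp_inj_on[OF bij]]) (auto simp: good_matrices_def)
  then have "card ?L = card (good_matrices \<delta> k n :: (nat \<times> nat \<Rightarrow> 'g \<Rightarrow> 'f) set)"
    by (rule card_image)
  ultimately have "card ?R = card (good_matrices \<delta> k n :: (nat \<times> nat \<Rightarrow> 'g \<Rightarrow> 'f) set)"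
    by (simp only:)
  moreover have "card ?M = card ?PE" using bij by (rule bij_betw_same_card)
  ultimately show ?thesis by (simp only: prob_dist_gt_def Let_def k_def)
qed

text \<open>After grouping by the generated ideal \<open>J\<close>, each group has at most
  \<open>|J|^|S|\<close> members by \<open>coeff_in_comb_ideal\<close>. \<open>S\<close> will be
  \<open>{..<k}\<close> for all messages and \<open>{1..<k}\<close> for differences of messages with
  leading entry 1.\<close>

lemma sum_comb_ideal_le:
  fixes f :: "('g::{ab_group_add,finite} \<Rightarrow> 'f::{field,finite}) set \<Rightarrow> real"
  assumes S: "S \<subseteq> {..<k}" and f: "\<And>J. f J \<ge> 0"
  shows "(\<Sum>b\<in>zext S UNIV. f (comb_ideal k b)) \<le> (\<Sum>J | shift_subspace J. real (card J) ^ card S * f J)"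
proof -
  have fin: "finite S" using S finite_subset by blast
  let ?V = "zext S UNIV :: (nat \<Rightarrow> 'g \<Rightarrow> 'f) set"
  have "(\<Sum>b\<in>?V. f (comb_ideal k b))
      = (\<Sum>J | shift_subspace J. \<Sum>b\<in>{b\<in>?V. comb_ideal k b = J}. f (comb_ideal k b))"
    by (intro sum.group[symmetric]) (auto simp: finite_zext fin shift_subspace_comb_ideal)
  also have "\<dots> = (\<Sum>J | shift_subspace J. real (card {b\<in>?V. comb_ideal k b = J}) * f J)"
    by (intro sum.cong refl) simp
  also have "\<dots> \<le> (\<Sum>J | shift_subspace J. real (card J) ^ card S * f J)"
  proof (intro sum_mono mult_right_mono f)
    fix J :: "('g \<Rightarrow> 'f) set"
    have "{b\<in>?V. comb_ideal k b = J} \<subseteq> zext S J"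
    proof
      fix b assume b: "b \<in> {b\<in>?V. comb_ideal k b = J}"
      have "b i \<in> J" if "i \<in> S" for i
        using b coeff_in_comb_ideal[of i k b] S that by auto
      then show "b \<in> zext S J" using b by (simp add: zext_def)
    qed
    then have "card {b\<in>?V. comb_ideal k b = J} \<le> card (zext S J)"
      by (intro card_mono finite_zext fin) auto
    then show "real (card {b\<in>?V. comb_ideal k b = J}) \<le> real (card J) ^ card S"
      using fin by (simp add: card_zext flip: of_nat_power)
  qed
  finally show ?thesis .
qed

lemma card_matrices_pos: "card (matrices k n :: (nat \<times> nat \<Rightarrow> 'g::{ab_group_add,finite} \<Rightarrow> 'f::{field,finite}) set) > 0"
proof -
  have "(0 :: nat \<times> nat \<Rightarrow> 'g \<Rightarrow> 'f) \<in> matrices k n" by (simp add: zext_def)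
  then show ?thesis by (subst card_gt_0_iff) (auto simp: finite_zext)
qed

section \<open>Below the GV-bound\<close>

text \<open>The messages generating \<open>J\<close> contribute at most
  \<open>|J| powr (k - \<gamma>)\<close> to the union bound, with
  \<open>\<gamma> = n * gq q \<delta>\<close>. As \<open>k \<le> \<gamma>\<close>, this decreases in
  \<open>|J|\<close>, and a nonzero ideal has at least \<open>q\<close> elements.\<close>

lemma bad_fraction_le:
  fixes \<delta> :: real
  defines "q \<equiv> real CARD('f::{field,finite})"
  assumes \<delta>: "0 < \<delta>" "\<delta> < 1 - 1 / q" and k: "real k \<le> real n * gq q \<delta>"
  shows "\<bar>real (card (good_matrices \<delta> k n :: (nat \<times> nat \<Rightarrow> 'g::{ab_group_add,finite} \<Rightarrow> 'f) set))
      / real (card (matrices k n :: (nat \<times> nat \<Rightarrow> 'g \<Rightarrow> 'f) set)) - 1\<bar>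
    \<le> real (card {J :: ('g \<Rightarrow> 'f) set. shift_subspace J}) * q powr (real k - real n * gq q \<delta>)"
proof -
  let ?M = "matrices k n :: (nat \<times> nat \<Rightarrow> 'g \<Rightarrow> 'f) set"
  let ?G = "good_matrices \<delta> k n :: (nat \<times> nat \<Rightarrow> 'g \<Rightarrow> 'f) set"
  let ?V = "zext {..<k} UNIV :: (nat \<Rightarrow> 'g \<Rightarrow> 'f) set"
  define \<gamma> where "\<gamma> = real n * gq q \<delta>"
  have q: "q \<ge> 2" using card_field_ge_2[where 'f='f] by (simp add: q_def)
  define T where "T = {w :: nat \<Rightarrow> 'g \<Rightarrow> 'f. (\<exists>j<n. w j \<noteq> 0) \<and>
    real (word_weight n w) \<le> \<delta> * (real CARD('g) * real n)}"
  \<comment> \<open>The zero ideal yields only the zero word, which \<open>T\<close> excludes; for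
    it \<open>|J| powr (- \<gamma>)\<close> would be 1.\<close>
  define f where "f J = (if J = {0 :: 'g \<Rightarrow> 'f} then 0 else real (card J) powr (- \<gamma>))" for J
  have finM: "finite ?M" by (simp add: finite_zext)
  have M: "real (card ?M) > 0" using card_matrices_pos by simp
  have sub: "?G \<subseteq> ?M" by (auto simp: good_matrices_def)
  have "?M - ?G \<subseteq> (\<Union>b\<in>?V. {A\<in>?M. encode k b A \<in> T})"
  proof
    fix A assume "A \<in> ?M - ?G"
    then obtain b where b: "A \<in> ?M" "encode k b A \<in> T"
      by (auto simp: good_matrices_def T_def not_less)
    have "encode k (\<lambda>i. if i < k then b i else 0) A = encode k b A"
      unfolding encode_def by (intro ext fun_cong[OF comb_cong]) auto
    moreover have "(\<lambda>i. if i < k then b i else 0) \<in> ?V" by (simp add: zext_def)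
    ultimately show "A \<in> (\<Union>b\<in>?V. {A\<in>?M. encode k b A \<in> T})"
      using b by (intro UN_I[of "\<lambda>i. if i < k then b i else 0"] CollectI conjI) simp_all
  qed
  then have "card (?M - ?G) \<le> card (\<Union>b\<in>?V. {A\<in>?M. encode k b A \<in> T})"
    using finM by (intro card_mono finite_UN_I) (auto simp: finite_zext)
  also have "\<dots> \<le> (\<Sum>b\<in>?V. card {A\<in>?M. encode k b A \<in> T})"
    by (intro card_UN_le) (simp add: finite_zext)
  finally have "real (card (?M - ?G)) \<le> (\<Sum>b\<in>?V. real (card {A\<in>?M. encode k b A \<in> T}))"
    by (simp flip: of_nat_sum)
  also have "\<dots> \<le> (\<Sum>b\<in>?V. real (card ?M) * f (comb_ideal k b))"
  proof (rule sum_mono)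
    fix b :: "nat \<Rightarrow> 'g \<Rightarrow> 'f"
    let ?J = "comb_ideal k b"
    have cJ: "real (card ?J) > 0" by (simp add: card_gt_0_iff)
    have "real (card (T \<inter> zext {..<n} ?J)) / real (card ?J) ^ n \<le> f ?J"
    proof (cases "?J = {0}")
      case True
      then have "T \<inter> zext {..<n} ?J = {}" by (auto simp: T_def zext_def)
      then show ?thesis using True by (simp add: f_def)
    next
      case False
      have "real (card (T \<inter> zext {..<n} ?J))
          \<le> real (card {v\<in>zext {..<n} ?J. real (word_weight n (0 + v)) \<le> \<delta> * (real CARD('g) * real n)})"
        by (intro of_nat_mono card_mono) (auto simp: T_def finite_zext)
      also have "\<dots> \<le> real (card ?J) powr (real n * hq q \<delta>)"
        unfolding q_def using \<delta> by (intro card_coset_ball_le shift_subspace_comb_ideal) (auto simp: q_def)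
      finally have "real (card (T \<inter> zext {..<n} ?J)) / real (card ?J) ^ n
          \<le> real (card ?J) powr (real n * hq q \<delta>) / real (card ?J) powr (real n)"
        using cJ by (simp add: powr_realpow divide_right_mono)
      also have "\<dots> = real (card ?J) powr (- \<gamma>)"
        by (simp add: powr_diff[symmetric] \<gamma>_def gq_def algebra_simps)
      finally show ?thesis using False by (simp add: f_def)
    qed
    then have "real (card ?M) * (real (card (T \<inter> zext {..<n} ?J)) / real (card ?J) ^ n) \<le> real (card ?M) * f ?J"
      by (intro mult_left_mono) auto
    then show "real (card {A\<in>?M. encode k b A \<in> T}) \<le> real (card ?M) * f ?J"
      unfolding card_encode_in by (simp only: times_divide_eq_right)
  qed
  also have "\<dots> = real (card ?M) * (\<Sum>b\<in>?V. f (comb_ideal k b))" by (simp add: sum_distrib_left)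
  also have "\<dots> \<le> real (card ?M) * (\<Sum>J | shift_subspace J. real (card J) ^ card {..<k} * f J)"
    by (intro mult_left_mono sum_comb_ideal_le) (auto simp: f_def)
  also have "\<dots> \<le> real (card ?M) * (\<Sum>J :: ('g \<Rightarrow> 'f) set | shift_subspace J. q powr (real k - \<gamma>))"
  proof (intro mult_left_mono sum_mono)
    fix J :: "('g \<Rightarrow> 'f) set" assume "J \<in> {J. shift_subspace J}"
    then have J: "shift_subspace J" by simp
    show "real (card J) ^ card {..<k} * f J \<le> q powr (real k - \<gamma>)"
    proof (cases "J = {0}")
      case False
      obtain I :: "'g set" where cJ: "card J = CARD('f) ^ card I"
        by (rule information_set[OF J])
      have "card I \<noteq> 0"
      proof
        assume "card I = 0"
        then have "card J = 1" using cJ by simp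
        then show False using J False by (auto simp: card_1_singleton_iff shift_subspace_def)
      qed
      then have "q \<le> q ^ card I" using q by (intro self_le_power) auto
      then have qJ: "q \<le> real (card J)" by (simp add: cJ q_def)
      then have J0: "real (card J) > 0" using q by linarith
      have "real (card J) ^ card {..<k} * f J = real (card J) powr (real k - \<gamma>)"
        using J0 False by (simp add: f_def powr_realpow[symmetric] powr_add[symmetric])
      also have "\<dots> \<le> q powr (real k - \<gamma>)"
        using k q qJ by (intro powr_mono2') (auto simp: \<gamma>_def)
      finally show ?thesis .
    qed (simp add: f_def)
  qed simp
  finally have bad: "real (card (?M - ?G)) \<le> real (card ?M)
      * (real (card {J :: ('g \<Rightarrow> 'f) set. shift_subspace J}) * q powr (real k - \<gamma>))" by simp
  have "real (card ?G) / real (card ?M) - 1 = - (real (card (?M - ?G)) / real (card ?M))"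
  proof -
    have "card (?M - ?G) = card ?M - card ?G" "card ?G \<le> card ?M"
      using sub finM by (auto intro: card_Diff_subset card_mono finite_subset)
    then have "real (card (?M - ?G)) = real (card ?M) - real (card ?G)" by (simp add: of_nat_diff)
    then show ?thesis using M by (simp add: diff_divide_distrib)
  qed
  then have "\<bar>real (card ?G) / real (card ?M) - 1\<bar> = real (card (?M - ?G)) / real (card ?M)" by simp
  also have "\<dots> \<le> real (card {J :: ('g \<Rightarrow> 'f) set. shift_subspace J}) * q powr (real k - \<gamma>)"
    using bad M by (simp add: pos_divide_le_eq mult.commute)
  finally show ?thesis by (simp add: \<gamma>_def)
qed

section \<open>Above the GV-bound\<close>

text \<open>For a good matrix no message \<open>e + x\<close> gives a word of weight exactly
  \<open>t\<close>, which the second moment shows to be rare. The variance is at most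
  \<open>F / (L * p)\<close> times the squared mean; up to the number of ideals,
  \<open>(R / q) powr s\<close> against \<open>R powr (s - n * \<epsilon>)\<close> leaves
  \<open>q powr (m * n * \<epsilon> - s)\<close>.\<close>

lemma good_fraction_le:
  fixes \<delta> \<epsilon> :: real and k n :: nat
  defines "q \<equiv> real CARD('f::{field,finite})" and "m \<equiv> CARD('g::{ab_group_add,finite})"
  defines "t \<equiv> nat \<lfloor>\<delta> * real (m * n)\<rfloor>"
  assumes \<delta>: "0 < \<delta>" "\<delta> < 1 - 1 / q" and k: "k > 0" "real n * gq q \<delta> \<le> real (k - 1)"
    and t: "t > 0"
    and vol: "q powr (real (m * n) * (hq q \<delta> - \<epsilon>)) \<le> real (m * n choose t) * (q - 1) ^ t"
  shows "real (card (good_matrices \<delta> k n :: (nat \<times> nat \<Rightarrow> 'g \<Rightarrow> 'f) set))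
      / real (card (matrices k n :: (nat \<times> nat \<Rightarrow> 'g \<Rightarrow> 'f) set))
    \<le> real (card {J :: ('g \<Rightarrow> 'f) set. shift_subspace J})
      * q powr (real (m * n) * \<epsilon> - (real (k - 1) - real n * gq q \<delta>))"
proof -
  let ?M = "matrices k n :: (nat \<times> nat \<Rightarrow> 'g \<Rightarrow> 'f) set"
  let ?G = "good_matrices \<delta> k n :: (nat \<times> nat \<Rightarrow> 'g \<Rightarrow> 'f) set"
  \<comment> \<open>Only the entries 1 to \<open>k - 1\<close> vary, since entry 0 of the message
    \<open>e + x\<close> is fixed to the unit.\<close>
  define E where "E = (zext {1..<k} UNIV :: (nat \<Rightarrow> 'g \<Rightarrow> 'f) set)"
  \<comment> \<open>A sphere inside the ball of relative radius \<delta>; it misses the zero word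
    because \<open>t > 0\<close>.\<close>
  define B where "B = {v\<in>zext {..<n} (UNIV :: ('g \<Rightarrow> 'f) set). word_weight n v = t}"
  define e where "e = ((\<lambda>i. if i = 0 then galg_one else 0) :: nat \<Rightarrow> 'g \<Rightarrow> 'f)"
  define R where "R = real CARD('g \<Rightarrow> 'f)"
  define p where "p = real (card B) / R ^ n"
  define \<gamma> where "\<gamma> = real n * gq q \<delta>"
  \<comment> \<open>Value 0 at the full ideal: two codewords whose messages differ by a generator of
    \<open>FG\<close> are independent, and \<open>p\<^sup>2\<close> already accounts for
    them.\<close>
  define f where "f J = (if J = (UNIV :: ('g \<Rightarrow> 'f) set) then 0 else real (card J) powr (- \<gamma>))" for J
  define F where "F = (\<Sum>J | shift_subspace J. real (card J) ^ (k - 1) * f J)"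
  define L where "L = R ^ (k - 1)"
  have q: "q \<ge> 2" using card_field_ge_2[where 'f='f] by (simp add: q_def)
  have R: "R = q ^ m" by (simp add: R_def q_def m_def card_fun)
  have R0: "R > 0" using q by (simp add: R)
  have finM: "finite ?M" by (simp add: finite_zext)
  have finE: "finite E" by (simp add: E_def finite_zext)
  have finB: "finite B" by (simp add: B_def finite_zext)
  have M: "real (card ?M) > 0" using card_matrices_pos by simp
  have L: "real (card E) = L" by (simp add: E_def L_def R_def card_zext)
  have L0: "L > 0" using R0 by (simp add: L_def)
  have x0: "x 0 = 0" if "x \<in> E" for x using that by (auto simp: E_def zext_def)
  have wt: "real (word_weight n v) \<le> \<delta> * (real CARD('g) * real n)" if "v \<in> B" for v
  proof -
    have "real t \<le> \<delta> * real (m * n)" unfolding t_def using \<delta> by (intro of_nat_floor) auto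
    then show ?thesis using that by (simp add: B_def m_def)
  qed
  have full: "comb_ideal k (e + x) = UNIV" if "x \<in> E" for x
  proof -
    have "c = comb k (e + x) (\<lambda>j. if j = 0 then c else 0)" for c
      unfolding comb_single[OF k(1)] using x0[OF that] by (simp add: e_def galg_mult_one_left)
    then show ?thesis unfolding comb_ideal_def by blast
  qed
  have first: "real (card {A\<in>?M. encode k (e + x) A \<in> B}) = p * real (card ?M)" if "x \<in> E" for x
  proof -
    have "B \<inter> zext {..<n} UNIV = B" by (auto simp: B_def)
    then show ?thesis unfolding card_encode_in full[OF that] p_def R_def by simp
  qed
  have pair: "real (card {A\<in>?M. encode k (e + x) A \<in> B \<and> encode k (e + y) A \<in> B})
      \<le> real (card ?M) * (p\<^sup>2 + p * f (comb_ideal k (y - x)))" if xy: "x \<in> E" "y \<in> E" for x y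
  proof -
    let ?J = "comb_ideal k (y - x)"
    let ?W = "\<lambda>u. {v\<in>zext {..<n} ?J. u + v \<in> B}"
    have cJ: "real (card ?J) > 0" by (simp add: card_gt_0_iff)
    have "{(u, v). u \<in> B \<inter> zext {..<n} UNIV \<and> u + v \<in> B \<and> v \<in> zext {..<n} ?J} = (SIGMA u:B. ?W u)"
      by (auto simp: B_def)
    then have "real (card {A\<in>?M. encode k (e + x) A \<in> B \<and> encode k (e + y) A \<in> B})
      = real (card ?M) * real (card (SIGMA u:B. ?W u)) / (R ^ n * real (card ?J) ^ n)"
      using card_encode_pair_in[of k x y n B B, OF k(1) x0[OF xy(1)] x0[OF xy(2)]]
      unfolding e_def R_def by (simp only:)
    also have "\<dots> = real (card ?M) * (real (card (SIGMA u:B. ?W u)) / (R ^ n * real (card ?J) ^ n))"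
      by simp
    also have "\<dots> \<le> real (card ?M) * (p\<^sup>2 + p * f ?J)"
    proof (rule mult_left_mono)
      have sig: "real (card (SIGMA u:B. ?W u)) = (\<Sum>u\<in>B. real (card (?W u)))"
        using finB by (subst card_SigmaI) (auto simp: finite_zext)
      show "real (card (SIGMA u:B. ?W u)) / (R ^ n * real (card ?J) ^ n) \<le> p\<^sup>2 + p * f ?J"
      proof (cases "?J = UNIV")
        case True
        have "real (card (?W u)) \<le> real (card B)" for u
          using finB by (intro of_nat_mono card_inj_on_le[where f = "\<lambda>v. u + v"]) auto
        then have "(\<Sum>u\<in>B. real (card (?W u))) \<le> (\<Sum>u\<in>B. real (card B))" by (intro sum_mono) auto
        then have "real (card (SIGMA u:B. ?W u)) \<le> real (card B) * real (card B)" by (simp add: sig)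
        then have "real (card (SIGMA u:B. ?W u)) / (R ^ n * R ^ n) \<le> real (card B) * real (card B) / (R ^ n * R ^ n)"
          using R0 by (intro divide_right_mono) auto
        moreover have "real (card ?J) = R" by (simp only: True R_def)
        ultimately show ?thesis using True by (simp add: f_def p_def power2_eq_square)
      next
        case False
        \<comment> \<open>Enlarging the sphere to the ball makes \<open>card_coset_ball_le\<close>
          applicable with offset \<open>u\<close>.\<close>
        have "real (card (?W u)) \<le> real (card ?J) powr (real n * hq q \<delta>)" for u
        proof -
          have "real (card (?W u))
            \<le> real (card {v\<in>zext {..<n} ?J. real (word_weight n (u + v)) \<le> \<delta> * (real CARD('g) * real n)})"
            using wt by (intro of_nat_mono card_mono) (auto simp: finite_zext)
          also have "\<dots> \<le> real (card ?J) powr (real n * hq q \<delta>)"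
            unfolding q_def using \<delta> by (intro card_coset_ball_le shift_subspace_comb_ideal) (auto simp: q_def)
          finally show ?thesis .
        qed
        then have "(\<Sum>u\<in>B. real (card (?W u))) \<le> (\<Sum>u\<in>B. real (card ?J) powr (real n * hq q \<delta>))"
          by (intro sum_mono) auto
        then have "real (card (SIGMA u:B. ?W u)) / (R ^ n * real (card ?J) ^ n)
            \<le> real (card B) * real (card ?J) powr (real n * hq q \<delta>) / (R ^ n * real (card ?J) ^ n)"
          using R0 unfolding sig by (intro divide_right_mono) auto
        also have "\<dots> = p * (real (card ?J) powr (real n * hq q \<delta>) / real (card ?J) powr real n)"
          using cJ by (simp add: p_def powr_realpow)
        also have "\<dots> = p * f ?J"
          using False by (simp add: f_def powr_diff[symmetric] \<gamma>_def gq_def algebra_simps)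
        finally show ?thesis by (simp add: add_increasing)
      qed
    qed simp
    finally show ?thesis .
  qed
  have f0: "f J \<ge> 0" for J by (simp add: f_def)
  have p0: "p \<ge> 0" using R0 by (simp add: p_def)
  have "(\<Sum>x\<in>E. \<Sum>y\<in>E. real (card {A\<in>?M. encode k (e + x) A \<in> B \<and> encode k (e + y) A \<in> B}))
      \<le> (\<Sum>x\<in>E. \<Sum>y\<in>E. real (card ?M) * (p\<^sup>2 + p * f (comb_ideal k (y - x))))"
    by (intro sum_mono pair)
  also have "\<dots> = (\<Sum>x\<in>E. real (card ?M) * (L * p\<^sup>2 + p * (\<Sum>y\<in>E. f (comb_ideal k (y - x)))))"
    by (simp add: sum_distrib_left[symmetric] sum.distrib L)
  also have "\<dots> \<le> (\<Sum>x\<in>E. real (card ?M) * (L * p\<^sup>2 + p * F))"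
  proof (intro sum_mono mult_left_mono add_left_mono p0)
    fix x assume x: "x \<in> E"
    \<comment> \<open>Differences with a fixed \<open>x\<close> run through \<open>E\<close> again,
      so the inner sum does not depend on \<open>x\<close>.\<close>
    have "bij_betw (\<lambda>y. y - x) E E"
      using x unfolding E_def
      by (intro bij_betwI[where g = "\<lambda>y. y + x"]) (auto intro: zext_add zext_diff)
    then have "(\<Sum>y\<in>E. f (comb_ideal k (y - x))) = (\<Sum>y\<in>E. f (comb_ideal k y))"
      by (rule sum.reindex_bij_betw)
    also have "\<dots> \<le> F"
      using sum_comb_ideal_le[of "{1..<k}" k f, OF _ f0] by (simp add: E_def F_def subset_eq)
    finally show "(\<Sum>y\<in>E. f (comb_ideal k (y - x))) \<le> F" .
  qed simp
  also have "\<dots> = real (card ?M) * ((real (card E) * p)\<^sup>2 + L * p * F)"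
    by (simp add: L power2_eq_square algebra_simps)
  finally have "real (card {A\<in>?M. \<forall>x\<in>E. \<not> encode k (e + x) A \<in> B}) * (real (card E) * p)\<^sup>2
      \<le> real (card ?M) * (L * p * F)"
    by (intro second_moment_bound finM finE first)
  moreover have "?G \<subseteq> {A\<in>?M. \<forall>x\<in>E. \<not> encode k (e + x) A \<in> B}"
  proof (intro subsetI CollectI conjI ballI notI)
    fix A assume A: "A \<in> ?G"
    then show "A \<in> ?M" by (simp add: good_matrices_def)
    fix x assume *: "encode k (e + x) A \<in> B"
    have "\<exists>j<n. encode k (e + x) A j \<noteq> 0"
    proof (rule ccontr)
      assume "\<not> ?thesis"
      then have "word_weight n (encode k (e + x) A) = 0" by (simp add: word_weight_def galg_weight_def)
      then show False using * t by (simp add: B_def)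
    qed
    then have "\<delta> * (real CARD('g) * real n) < real (word_weight n (encode k (e + x) A))"
      using A unfolding good_matrices_def by blast
    then show False using wt[OF *] by simp
  qed
  then have "real (card ?G) \<le> real (card {A\<in>?M. \<forall>x\<in>E. \<not> encode k (e + x) A \<in> B})"
    using finM by (intro of_nat_mono card_mono) auto
  then have "real (card ?G) * (real (card E) * p)\<^sup>2
      \<le> real (card {A\<in>?M. \<forall>x\<in>E. \<not> encode k (e + x) A \<in> B}) * (real (card E) * p)\<^sup>2"
    by (intro mult_right_mono) auto
  ultimately have sm: "real (card ?G) * (L * p)\<^sup>2 \<le> real (card ?M) * (L * p * F)"
    unfolding L by linarith
  have Rpow: "R powr a = q powr (real m * a)" for a
    using q by (simp add: R powr_realpow[symmetric] powr_powr)
  have Bge: "R powr (real n * (hq q \<delta> - \<epsilon>)) \<le> real (card B)"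
  proof -
    have "R powr (real n * (hq q \<delta> - \<epsilon>)) = q powr (real (m * n) * (hq q \<delta> - \<epsilon>))"
      by (simp add: Rpow mult_ac)
    also have "\<dots> \<le> real (m * n choose t) * (q - 1) ^ t" by (rule vol)
    also have "\<dots> \<le> real (card B)" unfolding q_def m_def B_def by (rule card_sphere_ge)
    finally show ?thesis .
  qed
  have pge: "R powr (- (\<gamma> + real n * \<epsilon>)) \<le> p"
  proof -
    have "R powr (- (\<gamma> + real n * \<epsilon>)) = R powr (real n * (hq q \<delta> - \<epsilon>)) / R powr real n"
      by (simp add: powr_diff[symmetric] \<gamma>_def gq_def algebra_simps)
    also have "\<dots> \<le> real (card B) / R powr real n" using Bge by (intro divide_right_mono) auto
    finally show ?thesis using R0 by (simp add: p_def powr_realpow)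
  qed
  define s where "s = real (k - 1) - \<gamma>"
  have s: "s \<ge> 0" using k by (simp add: s_def \<gamma>_def)
  have Fle: "F \<le> real (card {J :: ('g \<Rightarrow> 'f) set. shift_subspace J}) * (R / q) powr s"
  proof -
    have "F \<le> (\<Sum>J :: ('g \<Rightarrow> 'f) set | shift_subspace J. (R / q) powr s)"
      unfolding F_def
    proof (rule sum_mono)
      fix J :: "('g \<Rightarrow> 'f) set" assume "J \<in> {J. shift_subspace J}"
      then have J: "shift_subspace J" by simp
      show "real (card J) ^ (k - 1) * f J \<le> (R / q) powr s"
      proof (cases "J = UNIV")
        case False
        obtain I :: "'g set" where cJ: "card J = CARD('f) ^ card I"
          by (rule information_set[OF J])
        \<comment> \<open>\<open>|J|\<close> and \<open>R\<close> are both powers of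
          \<open>q\<close>, so a proper ideal is smaller by a full factor \<open>q\<close>; this
          factor is the source of the exponential decay.\<close>
        have "card J < CARD('g \<Rightarrow> 'f)" using False by (intro psubset_card_mono) auto
        then have "real (card J) < R" by (simp only: R_def of_nat_less_iff)
        then have "q ^ card I < q ^ m" by (simp add: cJ R q_def)
        then have "card I < m" using q by (simp add: power_strict_increasing_iff)
        then have "q ^ Suc (card I) \<le> q ^ m" using q by (intro power_increasing) auto
        then have Jle: "real (card J) \<le> R / q" using q by (simp add: cJ R q_def[symmetric] field_simps)
        have J0: "real (card J) > 0" using q by (simp add: cJ q_def)
        have "real (card J) ^ (k - 1) * f J = real (card J) powr s"
          using J0 False by (simp add: f_def s_def powr_realpow[symmetric] powr_add[symmetric])
        also have "\<dots> \<le> (R / q) powr s" using s J0 Jle by (intro powr_mono2) auto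
        finally show ?thesis .
      qed (simp add: f_def)
    qed
    then show ?thesis by simp
  qed
  have pp: "p > 0" using pge R0 by (smt (verit) powr_gt_zero)
  have "real (card ?G) / real (card ?M) \<le> F / (L * p)"
  proof -
    have "(real (card ?G) * (L * p)) * (L * p) \<le> (real (card ?M) * F) * (L * p)"
      using sm by (simp add: power2_eq_square mult_ac)
    then have "real (card ?G) * (L * p) \<le> real (card ?M) * F"
      using L0 pp by (simp only: mult_le_cancel_right_pos mult_pos_pos)
    then show ?thesis using L0 pp M by (simp add: divide_simps mult_ac)
  qed
  also have "\<dots> \<le> (real (card {J :: ('g \<Rightarrow> 'f) set. shift_subspace J}) * (R / q) powr s)
      / (R powr real (k - 1) * R powr (- (\<gamma> + real n * \<epsilon>)))"
  proof (rule frac_le)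
    show "R powr real (k - 1) * R powr (- (\<gamma> + real n * \<epsilon>)) \<le> L * p"
      unfolding L_def using pge R0 by (simp add: powr_realpow)
    show "R powr real (k - 1) * R powr (- (\<gamma> + real n * \<epsilon>)) > 0" using R0 by simp
  qed (use Fle in auto)
  also have "\<dots> = real (card {J :: ('g \<Rightarrow> 'f) set. shift_subspace J})
      * (R powr (s - (real (k - 1) - (\<gamma> + real n * \<epsilon>))) / q powr s)"
    using R0 q by (simp add: powr_divide powr_diff powr_add powr_minus field_simps)
  also have "s - (real (k - 1) - (\<gamma> + real n * \<epsilon>)) = real n * \<epsilon>" by (simp add: s_def)
  also have "R powr (real n * \<epsilon>) / q powr s = q powr (real (m * n) * \<epsilon> - s)"
    by (simp add: Rpow powr_diff mult_ac)
  finally show ?thesis by (simp add: s_def \<gamma>_def)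
qed

section \<open>Rates of convergence and conclusion\<close>

text \<open>The estimate must hold for every \<open>n > 0\<close>, so the finitely many early
  values, each multiplied by \<open>exp (c * n)\<close>, are added to the constant.\<close>

lemma exponential_bound:
  fixes f :: "nat \<Rightarrow> real" and c C :: real
  assumes c: "c > 0" and ev: "\<forall>\<^sub>F n in sequentially. \<bar>f n\<bar> \<le> C * exp (- c * real n)"
  shows "f \<longlonglongrightarrow> 0 \<and> (\<exists>c>0. \<exists>C. \<forall>n>0. \<bar>f n\<bar> \<le> C * exp (- c * real n))"
proof
  have "(\<lambda>n. C * exp (- c * real n)) \<longlonglongrightarrow> 0" using c by real_asymp
  then show "f \<longlonglongrightarrow> 0"
    by (rule Lim_null_comparison[rotated]) (use ev in simp)
  obtain n0 where n0: "\<And>n. n \<ge> n0 \<Longrightarrow> \<bar>f n\<bar> \<le> C * exp (- c * real n)"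
    using ev by (auto simp: eventually_sequentially)
  define D where "D = \<bar>C\<bar> + (\<Sum>n<n0. \<bar>f n\<bar> * exp (c * real n))"
  have "\<bar>f n\<bar> \<le> D * exp (- c * real n)" for n
  proof (cases "n \<ge> n0")
    case True
    have "C \<le> D" unfolding D_def by (smt (verit) sum_nonneg abs_ge_zero exp_ge_zero mult_nonneg_nonneg)
    then have "C * exp (- c * real n) \<le> D * exp (- c * real n)" by (intro mult_right_mono) auto
    then show ?thesis using n0[OF True] by linarith
  next
    case False
    have "\<bar>f n\<bar> * exp (c * real n) \<le> (\<Sum>n<n0. \<bar>f n\<bar> * exp (c * real n))"
      using False by (intro member_le_sum) auto
    then have "\<bar>f n\<bar> * exp (c * real n) \<le> D" by (simp add: D_def)
    then have "\<bar>f n\<bar> * exp (c * real n) * exp (- c * real n) \<le> D * exp (- c * real n)"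
      by (intro mult_right_mono) auto
    then show ?thesis by (simp add: mult.assoc exp_add[symmetric])
  qed
  then show "\<exists>c>0. \<exists>C. \<forall>n>0. \<bar>f n\<bar> \<le> C * exp (- c * real n)" using c by blast
qed

theorem theorem2p1:
  fixes r \<delta> :: real
  defines "q \<equiv> real CARD('f::{field,finite})"
  defines "P \<equiv> prob_dist_gt TYPE('f) TYPE('g::{ab_group_add,finite}) r \<delta>"
  assumes "0 < r" "r < 1" "0 < \<delta>" "\<delta> < 1 - 1 / q"
  shows "(r < gq q \<delta> \<longrightarrow> (P \<longlonglongrightarrow> 1) \<and>
            (\<exists>c>0. \<exists>C. \<forall>n>0. \<bar>P n - 1\<bar> \<le> C * exp (- c * real n)))
       \<and> (r > gq q \<delta> \<longrightarrow> (P \<longlonglongrightarrow> 0) \<and>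
            (\<exists>c>0. \<exists>C. \<forall>n>0. \<bar>P n\<bar> \<le> C * exp (- c * real n)))"
proof -
  define k where "k n = nat (round (r * real n))" for n :: nat
  define g where "g = gq q \<delta>"
  define m where "m = CARD('g)"
  define K where "K = real (card {J :: ('g \<Rightarrow> 'f) set. shift_subspace J})"
  have q: "q \<ge> 2" using card_field_ge_2[where 'f='f] by (simp add: q_def)
  then have \<delta>1: "\<delta> < 1" using assms by (smt (verit) divide_pos_pos)
  have m: "m > 0" by (simp add: m_def)
  have K: "K \<ge> 0" by (simp add: K_def)
  have k: "r * real n - 1 / 2 \<le> real (k n)" "real (k n) \<le> r * real n + 1 / 2" for n
  proof -
    have "round (r * real n) \<ge> 0"
      using assms round_mono[of 0 "r * real n"] by simp
    then have "real (k n) = of_int (round (r * real n))" by (simp add: k_def)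
    then show "r * real n - 1 / 2 \<le> real (k n)" "real (k n) \<le> r * real n + 1 / 2"
      using of_int_round_abs_le[of "r * real n"] by linarith+
  qed
  have P: "P n = real (card (good_matrices \<delta> (k n) n :: (nat \<times> nat \<Rightarrow> 'g \<Rightarrow> 'f) set))
      / real (card (matrices (k n) n :: (nat \<times> nat \<Rightarrow> 'g \<Rightarrow> 'f) set))" if "n > 0" for n
    unfolding P_def k_def using that by (rule prob_dist_gt_eq)
  have exp_form: "K * q powr (b - c * real n) = (K * q powr b) * exp (- (c * ln q) * real n)" for b c n
  proof -
    have "q powr (b - c * real n) = exp (b * ln q + (- (c * ln q) * real n))"
      using q by (simp add: powr_def algebra_simps)
    also have "\<dots> = q powr b * exp (- (c * ln q) * real n)"
      using q unfolding exp_add by (simp add: powr_def)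
    finally show ?thesis by (simp only: mult.assoc)
  qed
  show ?thesis
  proof (intro conjI impI)
    assume "r < gq q \<delta>"
    then have rg: "g - r > 0" by (simp add: g_def)
    \<comment> \<open>From here on the rounding error 1/2 cannot push \<open>k n\<close> above
      \<open>n * g\<close>, as \<open>bad_fraction_le\<close> requires; the same 1/2 reappears in
      the constant.\<close>
    have "\<forall>\<^sub>F n in sequentially. 1 / 2 \<le> (g - r) * real n" using rg by real_asymp
    then have "\<forall>\<^sub>F n in sequentially. \<bar>P n - 1\<bar> \<le> (K * q powr (1 / 2)) * exp (- ((g - r) * ln q) * real n)"
      using eventually_gt_at_top[of 0]
    proof eventually_elim
      case (elim n)
      have kle: "real (k n) - real n * g \<le> 1 / 2 - (g - r) * real n"
        using k(2)[of n] by (simp add: algebra_simps)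
      then have "real (k n) \<le> real n * gq q \<delta>" using elim by (simp add: g_def)
      then have "\<bar>P n - 1\<bar> \<le> K * q powr (real (k n) - real n * g)"
        unfolding P[OF elim(2)] K_def g_def q_def using assms by (intro bad_fraction_le) (auto simp: q_def)
      also have "\<dots> \<le> K * q powr (1 / 2 - (g - r) * real n)"
        using kle q K by (intro mult_left_mono powr_mono) auto
      finally show ?case by (simp only: exp_form)
    qed
    then have "(\<lambda>n. P n - 1) \<longlonglongrightarrow> 0 \<and> (\<exists>c>0. \<exists>C. \<forall>n>0. \<bar>P n - 1\<bar> \<le> C * exp (- c * real n))"
      by (rule exponential_bound[rotated]) (use rg q in simp)
    then show "P \<longlonglongrightarrow> 1" "\<exists>c>0. \<exists>C. \<forall>n>0. \<bar>P n - 1\<bar> \<le> C * exp (- c * real n)"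
      using LIM_zero_cancel[of P 1] by auto
  next
    assume "r > gq q \<delta>"
    then have rg: "r - g > 0" by (simp add: g_def)
    \<comment> \<open>Makes \<open>m * n * \<epsilon>\<close> half of the linear gain
      \<open>(r - g) * n\<close>; the other half survives as the rate.\<close>
    define \<epsilon> where "\<epsilon> = (r - g) / (2 * real m)"
    have \<epsilon>: "\<epsilon> > 0" using rg m by (simp add: \<epsilon>_def)
    have m\<epsilon>: "real (m * n) * \<epsilon> = (r - g) / 2 * real n" for n using m by (simp add: \<epsilon>_def)
    have "\<forall>\<^sub>F n in sequentially. 0 < nat \<lfloor>\<delta> * real (m * n)\<rfloor> \<and>
        q powr (real (m * n) * (hq q \<delta> - \<epsilon>))
          \<le> real (m * n choose nat \<lfloor>\<delta> * real (m * n)\<rfloor>) * (q - 1) ^ nat \<lfloor>\<delta> * real (m * n)\<rfloor>"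
      using eventually_powr_hq_le_binomial[of q \<delta> \<epsilon>] q assms(5) \<delta>1 \<epsilon> m
      by (intro eventually_compose_filterlim[of _ sequentially "\<lambda>n. m * n"] mult_nat_left_at_top) auto
    \<comment> \<open>3/2 is the rounding error 1/2 plus the coordinate lost in
      \<open>k n - 1\<close>.\<close>
    moreover have "\<forall>\<^sub>F n in sequentially. 3 / 2 \<le> (r - g) * real n" using rg by real_asymp
    \<comment> \<open>Ensures \<open>k n > 0\<close>, so that a leading coordinate exists.\<close>
    moreover have "\<forall>\<^sub>F n in sequentially. 1 / 2 < r * real n" using assms(3) by real_asymp
    ultimately have "\<forall>\<^sub>F n in sequentially. \<bar>P n\<bar> \<le> (K * q powr (3 / 2)) * exp (- ((r - g) / 2 * ln q) * real n)"
      using eventually_gt_at_top[of 0]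
    proof eventually_elim
      case (elim n)
      have kpos: "k n > 0" using k(1)[of n] elim(3) by (smt (verit) of_nat_0_less_iff)
      have kge: "(r - g) * real n - 3 / 2 \<le> real (k n - 1) - real n * g"
        using k(1)[of n] kpos by (simp add: of_nat_diff algebra_simps)
      have "P n \<le> K * q powr (real (m * n) * \<epsilon> - (real (k n - 1) - real n * g))"
        unfolding P[OF elim(4)] K_def g_def q_def m_def
        using elim(1,2) kpos kge assms
        by (intro good_fraction_le) (auto simp: q_def m_def g_def)
      also have "\<dots> \<le> K * q powr (3 / 2 - (r - g) / 2 * real n)"
        unfolding m\<epsilon> using kge q K by (intro mult_left_mono powr_mono) (auto simp: field_simps)
      finally have "P n \<le> K * q powr (3 / 2 - (r - g) / 2 * real n)" .
      moreover have "P n \<ge> 0" by (simp add: P[OF elim(4)])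
      ultimately show ?case by (simp only: exp_form abs_of_nonneg)
    qed
    then have "P \<longlonglongrightarrow> 0 \<and> (\<exists>c>0. \<exists>C. \<forall>n>0. \<bar>P n\<bar> \<le> C * exp (- c * real n))"
      by (rule exponential_bound[rotated]) (use rg q in simp)
    then show "P \<longlonglongrightarrow> 0" "\<exists>c>0. \<exists>C. \<forall>n>0. \<bar>P n\<bar> \<le> C * exp (- c * real n)" by auto
  qed
qed

end
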